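(* Let $\gamma=\begin{pmatrix}a&b\\c&d\end{pmatrix}\in\Gamma_0(2)$, regarded modulo $\pm I_2$, and let $\gamma(F_0)=\{\frac{a\tau+b}{c\tau+d}:\tau\in F_0\}$. Then: (1) if $c=0$, the Eisenstein series $E_6(\tau)$ has exactly one critical point (zero of $E_6'$) in $\gamma(F_0)$; (2) if $c\neq 0$, $E_6(\tau)$ has exactly two different critical points in $\gamma(F_0)$.
   Context: $\mathbb H=\{\tau\in\mathbb C:\operatorname{Im}\tau>0\}$. $E_6(\tau)=1-504\sum_{k\ge1}\sigma_5(k)q^k$ with $q=e^{2\pi i\tau}$, $\sigma_5(k)=\sum_{d\mid k}d^5$; equivalently $E_6=\frac{27}{8\pi^6}g_3$ where $g_3(\tau)=140\sum_{(m,n)\in\mathbb Z^2\setminus\{(0,0)\}}(m\tau+n)^{-6}$. $\Gamma_0(2)=\{\begin{pmatrix}a&b\\c&d\end{pmatrix}\in SL(2,\mathbb Z): c\equiv 0\bmod 2\}$. $F_0=\{\tau\in\mathbb H: 0\le\operatorname{Re}\tau\le1,\ |\tau-\tfrac12|\ge\tfrac12\}$ is the basic fundamental domain of $\Gamma_0(2)$. *)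

theory Defs
  imports "HOL-Analysis.Analysis"
begin

definition upper_half_plane :: "complex set" where
  "upper_half_plane = {\<tau>. Im \<tau> > 0}"

definition divisor_sigma :: "nat \<Rightarrow> nat \<Rightarrow> nat" where
  "divisor_sigma s k = (\<Sum>d | d dvd k. d ^ s)"

text \<open>
  The normalised Eisenstein series of weight 6, as its \<open>q\<close>-series with \<open>q = exp (2 \<pi> \<i> \<tau>)\<close>.
  The sum over \<open>k \<ge> 1\<close> is shifted to start at \<open>0\<close>. The series converges exactly on the upper
  half plane, which is open, so \<open>deriv E6\<close> at a point there is the derivative of the modular form;
  values elsewhere are meaningless.
\<close>

definition E6 :: "complex \<Rightarrow> complex" where
  "E6 \<tau> = 1 - 504 * (\<Sum>k. of_nat (divisor_sigma 5 (Suc k)) * exp (2 * pi * \<i> * \<tau>) ^ Suc k)"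

definition critical_points :: "(complex \<Rightarrow> complex) \<Rightarrow> complex set \<Rightarrow> complex set" where
  "critical_points f S = {z \<in> S. deriv f z = 0}"

definition Gamma0 :: "int \<Rightarrow> (int ^ 2 ^ 2) set" where
  "Gamma0 N = {A. det A = 1 \<and> N dvd A $ 2 $ 1}"

definition linear_fractional :: "int ^ 2 ^ 2 \<Rightarrow> complex \<Rightarrow> complex" where
  "linear_fractional A \<tau> = (of_int (A $ 1 $ 1) * \<tau> + of_int (A $ 1 $ 2)) /
                 (of_int (A $ 2 $ 1) * \<tau> + of_int (A $ 2 $ 2))"

text \<open>
  Matrices that agree up to sign act identically, so a claim about \<open>linear_fractional A\<close> and the vanishing
  of the lower left entry, quantified over all matrices \<open>A\<close>, is a claim about classes
  modulo \<open>\<plusminus>I\<close>.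
\<close>

lemma linear_fractional_uminus: "linear_fractional (- A) = linear_fractional A"
proof
  fix \<tau>
  have "linear_fractional (- A) \<tau> = (- (of_int (A $ 1 $ 1) * \<tau> + of_int (A $ 1 $ 2))) /
                 (- (of_int (A $ 2 $ 1) * \<tau> + of_int (A $ 2 $ 2)))"
    unfolding linear_fractional_def by simp
  then show "linear_fractional (- A) \<tau> = linear_fractional A \<tau>"
    unfolding linear_fractional_def by (simp only: minus_divide_divide)
qed

text \<open>The basic fundamental domain of \<open>\<Gamma>\<^sub>0(2)\<close>, with its whole boundary in the upper half plane.\<close>

definition F0 :: "complex set" where
  "F0 = {\<tau> \<in> upper_half_plane. 0 \<le> Re \<tau> \<and> Re \<tau> \<le> 1 \<and> cmod (\<tau> - 1 / 2) \<ge> 1 / 2}"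

end

theory Submission
  imports Defs
begin

text \<open>
  Put \<open>h(\<tau>) = \<tau> + 6 E\<^sub>6(\<tau>) / E\<^sub>6'(\<tau>)\<close>. Since \<open>E\<^sub>6\<close> is modular of weight 6, \<open>h\<close> commutes with the
  action of \<open>SL(2,\<int>)\<close>, so \<open>\<gamma>\<tau>\<close> is a critical point exactly when \<open>h(\<tau>) = - d / c\<close>, and the task is to
  count the solutions of \<open>h(\<tau>) = r\<close> in \<open>F\<^sub>0\<close> for \<open>r\<close> real or infinite. \<open>F\<^sub>0\<close> is the ideal triangle with cusps
  \<open>0, 1, \<infinity>\<close>; the rotation of order three about its centre and the reflection \<open>\<tau> \<mapsto> 1 - cnj \<tau>\<close>
  reduce the count to \<open>T = {0 \<le> Re \<tau> \<le> 1/2, |\<tau>| \<ge> 1}\<close>, where \<open>|q| < 0.0044\<close> and a few terms of the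
  \<open>q\<close>-expansion give full control. There the real points of \<open>h\<close> lie on a curve that is a graph over
  \<open>Im \<tau>\<close>, and \<open>h\<close> increases along it because \<open>Im h' < 0\<close>. Equivariance under \<open>\<tau> \<mapsto> - 1 / \<tau>\<close> forces
  \<open>h = 1\<close> where the curve enters \<open>T\<close> through the unit circle. Hence \<open>T\<close> contains exactly one solution
  for \<open>r \<ge> 1\<close> and none for other real \<open>r\<close>.
\<close>

section \<open>The Lipschitz formula and \<open>\<zeta>(6)\<close>\<close>

text \<open>The counts 1 and 2 come from an overlap of three pieces. The rotations act on levels by
  r -> 1 - 1/r -> 1/(1 - r), cycling the intervals r < 0, 0 < r < 1 and r > 1. The third of
  \<open>F0\<close> that reaches infinity takes every real value outside the open interval from 0 to
  1 exactly once, takes no value inside it, and has no pole. So for r different from 0, 1 and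
  infinity exactly two thirds contribute, at different points. For r infinite two thirds contribute
  as well, but at one point of their common boundary. As c is even and d odd, - d / c is never 0 or
  1, and it is infinite exactly for c = 0. Two obstacles shape the rest. The q-series hides the
  symmetry under \<tau> -> - 1 / \<tau>, so \<open>E6\<close> must be matched with a lattice sum,
  which needs the exact value of \<zeta>(6). And |q| tends to 1 at the cusps 0 and 1, where
  truncation of the series is useless; only after the rotations is |q| uniformly small.\<close>

lemma Digamma_reflection:
  fixes z :: complex
  assumes "z \<notin> \<int>"
  shows "Digamma z - Digamma (1 - z) = - of_real pi * cot (of_real pi * z)"
proof -
  have z1: "1 - z \<notin> \<int>" using assms Ints_diff[of 1 "1 - z"] by auto
  have s: "sin (of_real pi * z) \<noteq> 0"
    using assms by (subst sin_eq_0) (auto simp: field_simps)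
  have nz: "Gamma z * Gamma (1 - z) \<noteq> 0"
    using assms z1 by (auto simp: Gamma_eq_zero_iff dest: nonpos_Ints_Int)
  \<comment> \<open>Both sides of the reflection formula for \<open>Gamma\<close> are
    differentiated; dividing by the nonvanishing product leaves logarithmic derivatives.\<close>
  have "((\<lambda>z. Gamma z * Gamma (1 - z)) has_field_derivative
          Gamma z * Gamma (1 - z) * (Digamma z - Digamma (1 - z))) (at z)"
    using assms z1 nonpos_Ints_subset_Ints
    by (auto intro!: derivative_eq_intros simp: algebra_simps)
  moreover have "((\<lambda>z. Gamma z * Gamma (1 - z)) has_field_derivative
          of_real pi / sin (of_real pi * z) * (- of_real pi * cot (of_real pi * z))) (at z)"
    unfolding Gamma_reflection_complex using s
    by (auto intro!: derivative_eq_intros simp: cot_def field_simps)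
  ultimately have "Gamma z * Gamma (1 - z) * (Digamma z - Digamma (1 - z)) =
      Gamma z * Gamma (1 - z) * (- of_real pi * cot (of_real pi * z))"
    by (metis DERIV_unique Gamma_reflection_complex)
  with nz show ?thesis by (metis mult_left_cancel)
qed

text \<open>For n >= 1 this is (-1)^(n+1) n! times the sum of (z + k)^(-n-1) over all integers k,
  the reflected term supplying the negative k. It is also the n-th derivative of
  \<open>- pi * cot (pi * z)\<close>, which links sums over lattice rows with q-series.\<close>

definition polygamma_sym :: "nat \<Rightarrow> complex \<Rightarrow> complex" where
  "polygamma_sym n z = Polygamma n z - (-1) ^ n * Polygamma n (1 - z)"

lemma polygamma_sym_deriv:
  assumes "z \<notin> \<int>"
  shows "(polygamma_sym n has_field_derivative polygamma_sym (Suc n) z) (at z)"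
proof -
  have z1: "1 - z \<notin> \<int>" using assms Ints_diff[of 1 "1 - z"] by auto
  show ?thesis unfolding polygamma_sym_def[abs_def]
    using assms z1 nonpos_Ints_subset_Ints
    by (auto intro!: derivative_eq_intros simp: algebra_simps)
qed

text \<open>The recursion is the chain rule with cot' = - (1 + cot^2). Explicit polynomials matter
  at z = 1/2, where the cotangent vanishes and only the constant coefficient survives.\<close>

fun cot_poly :: "nat \<Rightarrow> complex poly" where
  "cot_poly 0 = [:0, - of_real pi:]"
| "cot_poly (Suc n) = smult (- of_real pi) ([:1, 0, 1:] * pderiv (cot_poly n))"

lemma polygamma_sym_eq_cot_poly:
  assumes "z \<notin> \<int>"
  shows "polygamma_sym n z = poly (cot_poly n) (cot (of_real pi * z))"
  using assms
proof (induction n arbitrary: z)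
  case 0
  then show ?case using Digamma_reflection[OF 0] by (simp add: polygamma_sym_def)
next
  case (Suc n)
  have s: "sin (of_real pi * z) \<noteq> 0"
    using Suc.prems by (subst sin_eq_0) (auto simp: field_simps)
  have sq: "inverse ((sin (of_real pi * z))\<^sup>2) = 1 + (cot (of_real pi * z))\<^sup>2"
    using s sin_cos_squared_add[of "of_real pi * z"] by (simp add: cot_def field_simps)
  have "((\<lambda>z. poly (cot_poly n) (cot (of_real pi * z))) has_field_derivative
      poly (cot_poly (Suc n)) (cot (of_real pi * z))) (at z)"
    by (rule derivative_eq_intros DERIV_cot s DERIV_chain2[OF DERIV_cot] DERIV_chain2[OF poly_DERIV] refl)+
       (simp only: sq, simp add: power2_eq_square algebra_simps)
  moreover have "((\<lambda>z. poly (cot_poly n) (cot (of_real pi * z))) has_field_derivative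
      polygamma_sym (Suc n) z) (at z)"
    by (rule has_field_derivative_transform_within_open[OF polygamma_sym_deriv[OF Suc.prems], of "- \<int>"])
       (use Suc in \<open>auto simp: open_Compl\<close>)
  ultimately show ?case by (rule DERIV_unique[symmetric])
qed

text \<open>The term at k = 0 vanishes for n > 0 but is 1 for n = 0, where the series is the full
  geometric one; hence the form \<open>2 * lipschitz_series 0 z - 1\<close> of the
  cotangent.\<close>

definition lipschitz_series :: "nat \<Rightarrow> complex \<Rightarrow> complex" where
  "lipschitz_series n z = (\<Sum>k. of_nat k ^ n * exp (2 * of_real pi * \<i> * z) ^ k)"

lemma summable_power_times_geometric:
  fixes w :: complex
  assumes "norm w < 1"
  shows "summable (\<lambda>k. of_nat k ^ n * w ^ k)"
  using assms
proof (induction n arbitrary: w)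
  case 0
  then show ?case by (simp add: summable_geometric)
next
  case (Suc n)
  have "summable (\<lambda>k. diffs (\<lambda>k. of_nat k ^ n) k * w ^ k)"
    by (rule termdiff_converges[OF Suc.prems]) (use Suc.IH in auto)
  then have "summable (\<lambda>k. w * (diffs (\<lambda>k. of_nat k ^ n) k * w ^ k))"
    by (rule summable_mult)
  also have "(\<lambda>k. w * (diffs (\<lambda>k. of_nat k ^ n) k * w ^ k)) = (\<lambda>k. of_nat (Suc k) ^ Suc n * w ^ Suc k)"
    by (auto simp: diffs_def)
  finally show ?case by (subst (asm) summable_Suc_iff)
qed

lemma norm_exp_2pi_i: "norm (exp (2 * of_real pi * \<i> * z)) = exp (- 2 * pi * Im z)"
  by (simp add: norm_exp_eq_Re)

text \<open>The operator q d/dq multiplies the k-th coefficient by k, and dq/dz = 2 \<pi> i q. The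
  index shift made by \<open>diffs\<close> is repaired by a head term that is zero.\<close>

lemma lipschitz_series_deriv:
  assumes "Im z > 0"
  shows "(lipschitz_series n has_field_derivative
           2 * of_real pi * \<i> * lipschitz_series (Suc n) z) (at z)"
proof -
  let ?q = "\<lambda>z. exp (2 * of_real pi * \<i> * z)"
  have q1: "norm (?q z) < 1" unfolding norm_exp_2pi_i using assms by simp
  have D: "((\<lambda>w. \<Sum>k. of_nat k ^ n * w ^ k) has_field_derivative
          (\<Sum>k. diffs (\<lambda>k. of_nat k ^ n) k * ?q z ^ k)) (at (?q z))"
    by (rule termdiffs_strong'[OF summable_power_times_geometric q1])
  have sd: "summable (\<lambda>k. diffs (\<lambda>k. of_nat k ^ n) k * ?q z ^ k)"
    by (rule termdiff_converges[OF q1 summable_power_times_geometric])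
  have "(\<Sum>k. diffs (\<lambda>k. of_nat k ^ n) k * ?q z ^ k) * ?q z =
        (\<Sum>k. ?q z * (diffs (\<lambda>k. of_nat k ^ n) k * ?q z ^ k))"
    by (subst suminf_mult[OF sd]) (simp add: mult.commute)
  also have "\<dots> = (\<Sum>k. of_nat (Suc k) ^ Suc n * ?q z ^ Suc k)"
    by (intro suminf_cong) (auto simp: diffs_def)
  also have "\<dots> = lipschitz_series (Suc n) z"
    unfolding lipschitz_series_def
    using summable_power_times_geometric[OF q1, of "Suc n"] by (subst suminf_split_head) auto
  finally have eq: "(\<Sum>k. diffs (\<lambda>k. of_nat k ^ n) k * ?q z ^ k) * ?q z = lipschitz_series (Suc n) z" .
  have q': "(?q has_field_derivative 2 * of_real pi * \<i> * ?q z) (at z)"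
    by (auto intro!: derivative_eq_intros)
  show ?thesis
    using DERIV_chain2[OF D q'] unfolding lipschitz_series_def[abs_def]
    using eq by (simp add: lipschitz_series_def mult_ac)
qed

lemma cot_eq_power_series:
  assumes "Im z > 0"
  shows "- of_real pi * cot (of_real pi * z) = of_real pi * \<i> * (2 * lipschitz_series 0 z - 1)"
proof -
  define e where "e = exp (of_real pi * \<i> * z)"
  have e2: "exp (2 * of_real pi * \<i> * z) = e\<^sup>2"
    by (simp add: e_def exp_double[symmetric] mult_ac)
  have "norm (exp (2 * of_real pi * \<i> * z)) < 1" unfolding norm_exp_2pi_i using assms by simp
  then have n: "norm (e\<^sup>2) < 1" by (simp only: e2)
  then have n1: "e\<^sup>2 \<noteq> 1" by auto
  have e0: "e \<noteq> 0" by (simp add: e_def)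
  have P: "lipschitz_series 0 z = 1 / (1 - e\<^sup>2)"
    unfolding lipschitz_series_def e2 using suminf_geometric[OF n] by simp
  have i1: "exp (\<i> * (of_real pi * z)) = e" "exp (- (\<i> * (of_real pi * z))) = inverse e"
    by (simp_all add: e_def exp_minus mult_ac)
  have C: "cot (of_real pi * z) = \<i> * (e + inverse e) / (e - inverse e)"
    unfolding cot_def sin_exp_eq cos_exp_eq i1 by (cases "e - inverse e = 0") (auto simp: divide_simps)
  have "e - inverse e \<noteq> 0" using e0 n1 by (auto simp: field_simps power2_eq_square)
  then have "cot (of_real pi * z) = \<i> * (e\<^sup>2 + 1) / (e\<^sup>2 - 1)"
    unfolding C using e0 n1 by (simp add: divide_simps power2_eq_square)
  then show ?thesis unfolding P using n1 by (simp add: divide_simps) (simp add: algebra_simps)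
qed

text \<open>Lipschitz's formula, by repeated differentiation of the cotangent identity. It starts at
  \<open>Suc n\<close> because the constant in that identity disappears only with the first
  derivative.\<close>

lemma polygamma_sym_eq_power_series:
  assumes "Im z > 0"
  shows "polygamma_sym (Suc n) z = (2 * of_real pi * \<i>) ^ (n + 2) * lipschitz_series (Suc n) z"
  using assms
proof (induction n arbitrary: z)
  case 0
  have nI: "w \<notin> \<int>" if "Im w > 0" for w using that by (auto simp: complex_is_Int_iff)
  have "((\<lambda>z. of_real pi * \<i> * (2 * lipschitz_series 0 z - 1)) has_field_derivative
      (2 * of_real pi * \<i>) ^ 2 * lipschitz_series (Suc 0) z) (at z)"
    by (rule derivative_eq_intros lipschitz_series_deriv 0 refl)+ (simp add: power2_eq_square)
  moreover have "((\<lambda>z. of_real pi * \<i> * (2 * lipschitz_series 0 z - 1)) has_field_derivative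
      polygamma_sym (Suc 0) z) (at z)"
    by (rule has_field_derivative_transform_within_open[OF polygamma_sym_deriv[OF nI[OF 0]], of "{z. Im z > 0}"])
       (use 0 nI Digamma_reflection cot_eq_power_series in \<open>auto simp: open_halfspace_Im_gt polygamma_sym_def[of 0]\<close>)
  ultimately show ?case using DERIV_unique by (metis add_0)
next
  case (Suc n)
  have nI: "w \<notin> \<int>" if "Im w > 0" for w using that by (auto simp: complex_is_Int_iff)
  have "((\<lambda>z. (2 * of_real pi * \<i>) ^ (n + 2) * lipschitz_series (Suc n) z) has_field_derivative
      (2 * of_real pi * \<i>) ^ (Suc n + 2) * lipschitz_series (Suc (Suc n)) z) (at z)"
    by (rule derivative_eq_intros lipschitz_series_deriv Suc.prems refl)+ (simp add: mult_ac)
  moreover have "((\<lambda>z. (2 * of_real pi * \<i>) ^ (n + 2) * lipschitz_series (Suc n) z) has_field_derivative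
      polygamma_sym (Suc (Suc n)) z) (at z)"
    by (rule has_field_derivative_transform_within_open[OF polygamma_sym_deriv[OF nI[OF Suc.prems]], of "{z. Im z > 0}"])
       (use Suc in \<open>auto simp: open_halfspace_Im_gt\<close>)
  ultimately show ?case using DERIV_unique by blast
qed

lemma has_sum_int_split:
  fixes f :: "int \<Rightarrow> complex"
  assumes "((\<lambda>k. f (int k)) has_sum a) UNIV" "((\<lambda>k. f (- int k - 1)) has_sum b) UNIV"
  shows "(f has_sum (a + b)) UNIV"
proof -
  have "(f has_sum a) {0..}"
    using assms(1) by (rule has_sum_reindex_bij_witness[of _ nat int, THEN iffD1, rotated -1]) auto
  moreover have "(f has_sum b) {..<0}"
    using assms(2) by (rule has_sum_reindex_bij_witness[of _ "\<lambda>i. nat (- i - 1)" "\<lambda>k. - int k - 1", THEN iffD1, rotated -1]) auto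
  ultimately have "(f has_sum (a + b)) ({0..} \<union> {..<0})"
    by (intro has_sum_Un_disjoint) auto
  moreover have "{0..} \<union> {..<0} = (UNIV :: int set)" by auto
  ultimately show ?thesis by simp
qed

lemma summable_inverse_shift_power6:
  fixes z :: complex
  shows "summable (\<lambda>k. norm (inverse ((z + of_nat k) ^ 6)))"
proof -
  \<comment> \<open>The first N + 1 terms, where z + k may vanish, are dropped; afterwards the
    triangle inequality gives |z + k + N + 1| >= k + 1.\<close>
  define N where "N = nat \<lceil>norm z\<rceil>"
  have "norm z \<le> N" unfolding N_def by linarith
  have "summable (\<lambda>k. inverse ((of_nat (Suc k))\<^sup>2 :: real))"
    using inverse_squares_sums by (simp add: sums_iff inverse_eq_divide add.commute)
  then have "summable (\<lambda>k. norm (inverse ((z + of_nat (k + (N + 1))) ^ 6)))"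
  proof (rule summable_comparison_test'[of _ 0])
    fix k
    have "real (Suc k) + N \<le> norm (of_nat (k + (N+1)) :: complex)" by (simp only: norm_of_nat)
    also have "\<dots> \<le> norm (z + of_nat (k + (N+1))) + norm z"
      by (metis add_diff_cancel_left' norm_triangle_ineq4)
    finally have a: "real (Suc k) \<le> norm (z + of_nat (k + (N+1)))" using \<open>norm z \<le> N\<close> by linarith
    have "(real (Suc k))\<^sup>2 \<le> real (Suc k) ^ 6" by (rule power_increasing) auto
    also have "\<dots> \<le> norm (z + of_nat (k + (N+1))) ^ 6" by (rule power_mono[OF a]) simp
    finally show "norm (norm (inverse ((z + of_nat (k + (N + 1))) ^ 6))) \<le> inverse ((of_nat (Suc k))\<^sup>2)"
      by (simp add: norm_inverse norm_power le_imp_inverse_le del: of_nat_Suc of_nat_add)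
  qed
  then show ?thesis by (subst (asm) summable_iff_shift)
qed

lemma has_sum_inverse_power6_int:
  assumes "z \<notin> \<int>"
  shows "((\<lambda>n. inverse ((z + of_int n) ^ 6)) has_sum (polygamma_sym 5 z / 120)) UNIV"
proof -
  have z1: "1 - z \<notin> \<int>" using assms Ints_diff[of 1 "1 - z"] by auto
  have sums: "((\<lambda>k. inverse ((w + of_nat k) ^ 6)) has_sum (Polygamma 5 w / 120)) UNIV"
    if "w \<notin> \<int>" for w :: complex
  proof (rule norm_summable_imp_has_sum)
    show "summable (\<lambda>k. norm (inverse ((w + of_nat k) ^ 6)))" by (rule summable_inverse_shift_power6)
    have "w \<noteq> 0" using that by auto
    moreover have "fact 5 = (120 :: complex)" by (simp add: fact_numeral)
    ultimately show "(\<lambda>k. inverse ((w + of_nat k) ^ 6)) sums (Polygamma 5 w / 120)"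
      using Polygamma_LIMSEQ[of w 5] by simp
  qed
  have "((\<lambda>n. inverse ((z + of_int n) ^ 6)) has_sum (Polygamma 5 z / 120 + Polygamma 5 (1 - z) / 120)) UNIV"
  proof (rule has_sum_int_split)
    show "((\<lambda>k. inverse ((z + of_int (int k)) ^ 6)) has_sum (Polygamma 5 z / 120)) UNIV"
      using sums[OF assms] by simp
    have "(z + of_int (- int k - 1)) ^ 6 = (1 - z + of_nat k) ^ 6" for k
    proof -
      have "z + of_int (- int k - 1) = - (1 - z + of_nat k)" by simp
      then show ?thesis by (simp only: power_minus_even even_numeral)
    qed
    then show "((\<lambda>k. inverse ((z + of_int (- int k - 1)) ^ 6)) has_sum (Polygamma 5 (1 - z) / 120)) UNIV"
      using sums[OF z1] by simp
  qed
  then show ?thesis by (simp add: polygamma_sym_def add_divide_distrib)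
qed

lemma has_sum_inverse_power6_lipschitz:
  assumes "Im z > 0"
  shows "((\<lambda>n. inverse ((z + of_int n) ^ 6)) has_sum
           (- 8 * of_real pi ^ 6 / 15 * lipschitz_series 5 z)) UNIV"
proof -
  have "z \<notin> \<int>" using assms by (auto simp: complex_is_Int_iff)
  \<comment> \<open>The constant is (2 \<pi> i)^6 / 5!.\<close>
  moreover have "polygamma_sym 5 z / 120 = - 8 * of_real pi ^ 6 / 15 * lipschitz_series 5 z"
    using polygamma_sym_eq_power_series[OF assms, of 4] 
    by (simp add: power_mult_distrib eval_nat_numeral)
  ultimately show ?thesis using has_sum_inverse_power6_int by metis
qed

lemma power6_minus: "(- a - 1) ^ 6 = (1 + a :: complex) ^ 6"
proof -
  have "- a - 1 = - (1 + a)" by simp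
  then show ?thesis by (simp only: power_minus_even even_numeral)
qed

text \<open>The odd terms are 1/64 of the sum of (1/2 + n)^(-6), which is a polynomial in
  cot(\<pi>/2) = 0. The even terms are 1/64 of the unknown total, so the total solves a linear
  equation.\<close>

lemma zeta6: "((\<lambda>n. inverse (of_int n ^ 6)) has_sum (2 * of_real pi ^ 6 / 945 :: complex)) (-{0})"
proof -
  let ?g = "\<lambda>n::int. inverse (of_int n ^ 6) :: complex"
  have half: "(1/2 :: complex) \<notin> \<int>" using fraction_not_in_Ints[of 2 1] by simp
  have c: "cot (of_real pi * (1/2)) = (0::complex)"
    using cos_of_real[of "pi/2", where 'a = complex] by (simp add: cot_def)
  have "polygamma_sym 5 (1/2) = poly (cot_poly 5) 0"
    using polygamma_sym_eq_cot_poly[OF half, of 5] unfolding c .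
  also have "\<dots> = 16 * of_real pi ^ 6"
    by (simp add: eval_nat_numeral pderiv_pCons)
  finally have "((\<lambda>n. inverse ((1/2 + of_int n) ^ 6)) has_sum (2 * of_real pi ^ 6 / 15 :: complex)) UNIV"
    using has_sum_inverse_power6_int[OF half] by simp
  then have "((\<lambda>n. 1/64 * inverse ((1/2 + of_int n) ^ 6)) has_sum (1/64 * (2 * of_real pi ^ 6 / 15) :: complex)) UNIV"
    by (rule has_sum_cmult_right)
  moreover have "1/64 * inverse ((1/2 + of_int n) ^ 6) = ?g (2 * n + 1)" for n
  proof -
    have "of_int (2 * n + 1) = 2 * (1/2 + of_int n :: complex)" by simp
    then show ?thesis by (simp only: power_mult_distrib inverse_mult_distrib) simp
  qed
  ultimately have "((\<lambda>n. ?g (2 * n + 1)) has_sum (of_real pi ^ 6 / 480)) UNIV" by simp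
  then have odd: "(?g has_sum (of_real pi ^ 6 / 480)) {n. odd n}"
    by (rule has_sum_reindex_bij_witness[of _ "\<lambda>n. n div 2" "\<lambda>n. 2 * n + 1", THEN iffD1, rotated -1]) auto
  have "(?g has_sum (infsum ?g (-{0}))) (-{0})"
  proof (rule has_sum_infsum)
    have "summable (\<lambda>k. norm (inverse ((1 + of_nat k :: complex) ^ 6)))"
      by (rule summable_inverse_shift_power6)
    then have s: "(\<lambda>k. inverse ((1 + of_nat k :: complex) ^ 6)) summable_on UNIV"
      by (rule norm_summable_imp_summable_on)
    have "?g summable_on {0<..}"
      using s by (rule summable_on_reindex_bij_witness[of _ "\<lambda>n. nat (n - 1)" "\<lambda>k. int k + 1", THEN iffD1, rotated -1]) (auto simp: add.commute)
    moreover have "?g summable_on {..<0}"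
      using s by (rule summable_on_reindex_bij_witness[of _ "\<lambda>n. nat (- n - 1)" "\<lambda>k. - int k - 1", THEN iffD1, rotated -1])
        (auto simp: power6_minus)
    ultimately have "?g summable_on ({0<..} \<union> {..<0})" by (rule summable_on_union)
    moreover have "{0<..} \<union> {..<0} = - {0 :: int}" by auto
    ultimately show "?g summable_on - {0}" by simp
  qed
  note all = this
  have "((\<lambda>n. 1/64 * ?g n) has_sum (1/64 * infsum ?g (-{0}))) (-{0})"
    by (rule has_sum_cmult_right[OF all])
  moreover have "1/64 * ?g n = ?g (2 * n)" for n
    by (simp add: power_mult_distrib)
  ultimately have "((\<lambda>n. ?g (2 * n)) has_sum (1/64 * infsum ?g (-{0}))) (-{0})" by simp
  then have even: "(?g has_sum (1/64 * infsum ?g (-{0}))) {n. even n \<and> n \<noteq> 0}"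
    by (rule has_sum_reindex_bij_witness[of _ "\<lambda>n. n div 2" "\<lambda>n. 2 * n", THEN iffD1, rotated -1]) auto
  have "(?g has_sum (of_real pi ^ 6 / 480 + 1/64 * infsum ?g (-{0}))) ({n. odd n} \<union> {n. even n \<and> n \<noteq> 0})"
    by (rule has_sum_Un_disjoint[OF odd even]) auto
  also have "{n. odd n} \<union> {n. even n \<and> n \<noteq> 0} = - {0 :: int}" by auto
  finally have "infsum ?g (-{0}) = of_real pi ^ 6 / 480 + 1/64 * infsum ?g (-{0})"
    using all has_sum_unique by blast
  then have "infsum ?g (-{0}) = 2 * of_real pi ^ 6 / 945" by (simp add: field_simps)
  with all show ?thesis by simp
qed

section \<open>Modularity of \<open>E\<^sub>6\<close>\<close>

lemma summable_on_product_nonneg: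
  fixes f g :: "_ \<Rightarrow> real"
  assumes "f summable_on A" "g summable_on B"
    and "\<And>x. x \<in> A \<Longrightarrow> f x \<ge> 0" "\<And>y. y \<in> B \<Longrightarrow> g y \<ge> 0"
  shows "(\<lambda>(x, y). f x * g y) summable_on A \<times> B"
proof (rule summable_on_SigmaI[where g = "\<lambda>x. f x * infsum g B"])
  show "((\<lambda>y. case (x, y) of (x, y) \<Rightarrow> f x * g y) has_sum f x * infsum g B) B" for x
    using has_sum_cmult_right[OF has_sum_infsum[OF assms(2)]] by simp
  show "(\<lambda>x. f x * infsum g B) summable_on A"
    by (rule summable_on_cmult_left[OF assms(1)])
qed (use assms in auto)

lemma summable_inverse_1_plus_square_int:
  "(\<lambda>n :: int. inverse (1 + (of_int n)\<^sup>2) :: real) summable_on UNIV"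
proof -
  have "summable (\<lambda>k. inverse (1 + (of_nat k)\<^sup>2 :: real))"
  proof (subst summable_Suc_iff[symmetric], rule summable_comparison_test'[of _ 0])
    show "summable (\<lambda>k. inverse ((of_nat (Suc k))\<^sup>2 :: real))"
      using inverse_squares_sums by (simp add: sums_iff inverse_eq_divide add.commute)
    show "norm (inverse (1 + (of_nat (Suc k))\<^sup>2 :: real)) \<le> inverse ((of_nat (Suc k))\<^sup>2)" for k
      by (simp add: le_imp_inverse_le del: of_nat_Suc)
  qed
  then have s: "(\<lambda>k. inverse (1 + (of_nat k)\<^sup>2 :: real)) summable_on UNIV"
    by (rule summable_nonneg_imp_summable_on) auto
  let ?g = "\<lambda>n :: int. inverse (1 + (of_int n)\<^sup>2) :: real"
  have "?g summable_on {0..}"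
    using s by (rule summable_on_reindex_bij_witness[of _ nat int, THEN iffD1, rotated -1]) auto
  moreover have "?g summable_on {..0}"
    using s by (rule summable_on_reindex_bij_witness[of _ "\<lambda>n. nat (- n)" "\<lambda>k. - int k", THEN iffD1, rotated -1]) auto
  ultimately have "?g summable_on ({0..} \<union> {..0})" by (rule summable_on_union)
  moreover have "{0..} \<union> {..0} = (UNIV :: int set)" by auto
  ultimately show ?thesis by simp
qed

text \<open>1 and \<tau> form a real basis of the plane: the imaginary part controls m, and
  subtracting m \<tau> then controls n.\<close>

lemma lattice_norm_bound:
  fixes \<tau> :: complex
  assumes "Im \<tau> > 0"
  obtains C where "C > 0" "\<And>m n :: real. m\<^sup>2 + n\<^sup>2 \<le> C * (norm (of_real m * \<tau> + of_real n))\<^sup>2"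
proof -
  define C where "C = (1 / Im \<tau>)\<^sup>2 + (1 + norm \<tau> / Im \<tau>)\<^sup>2"
  have "m\<^sup>2 + n\<^sup>2 \<le> C * (norm (of_real m * \<tau> + of_real n))\<^sup>2" for m n :: real
  proof -
    let ?w = "of_real m * \<tau> + of_real n"
    have "\<bar>m\<bar> * Im \<tau> = \<bar>Im ?w\<bar>" using assms by (simp add: abs_mult)
    also have "\<dots> \<le> norm ?w" by (rule abs_Im_le_cmod)
    finally have m: "\<bar>m\<bar> \<le> 1 / Im \<tau> * norm ?w" using assms by (simp add: field_simps)
    have "\<bar>n\<bar> = norm (?w - of_real m * \<tau>)" by simp
    also have "\<dots> \<le> norm ?w + \<bar>m\<bar> * norm \<tau>" by (metis norm_triangle_ineq4 norm_mult norm_of_real)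
    also have "\<dots> \<le> norm ?w + (1 / Im \<tau> * norm ?w) * norm \<tau>"
      using m by (intro add_left_mono mult_right_mono) auto
    also have "\<dots> = (1 + norm \<tau> / Im \<tau>) * norm ?w" by (simp add: algebra_simps)
    finally have n: "\<bar>n\<bar> \<le> (1 + norm \<tau> / Im \<tau>) * norm ?w" .
    have "m\<^sup>2 \<le> (1 / Im \<tau> * norm ?w)\<^sup>2" "n\<^sup>2 \<le> ((1 + norm \<tau> / Im \<tau>) * norm ?w)\<^sup>2"
      using power_mono[OF m, of 2] power_mono[OF n, of 2] by simp_all
    then have "m\<^sup>2 + n\<^sup>2 \<le> (1 / Im \<tau> * norm ?w)\<^sup>2 + ((1 + norm \<tau> / Im \<tau>) * norm ?w)\<^sup>2"
      by (rule add_mono)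
    also have "\<dots> = C * (norm ?w)\<^sup>2" unfolding C_def power_mult_distrib by (rule distrib_right[symmetric])
    finally show ?thesis .
  qed
  moreover have "C > 0" using assms by (auto simp: C_def intro!: add_pos_nonneg)
  ultimately show ?thesis using that by blast
qed

text \<open>This is g_3 / 140. Weight 6 gives absolute convergence, so the unordered sum may be
  split into rows and permuted freely.\<close>

definition lattice_sum6 :: "complex \<Rightarrow> complex" where
  "lattice_sum6 \<tau> = infsum (\<lambda>(m, n). inverse ((of_int m * \<tau> + of_int n) ^ 6)) (- {(0, 0)})"

lemma has_sum_lattice_sum6:
  assumes "Im \<tau> > 0"
  shows "((\<lambda>(m, n). inverse ((of_int m * \<tau> + of_int n) ^ 6)) has_sum lattice_sum6 \<tau>) (- {(0, 0)})"
  unfolding lattice_sum6_def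
proof (rule has_sum_infsum, rule abs_summable_summable)
  obtain C where C: "C > 0" "\<And>m n :: real. m\<^sup>2 + n\<^sup>2 \<le> C * (norm (of_real m * \<tau> + of_real n))\<^sup>2"
    using lattice_norm_bound[OF assms] by blast
  let ?g = "\<lambda>n :: int. inverse (1 + (of_int n)\<^sup>2) :: real"
  have "(\<lambda>(m, n). ?g m * ?g n) summable_on UNIV \<times> UNIV"
    by (intro summable_on_product_nonneg summable_inverse_1_plus_square_int) auto
  then have "(\<lambda>(m, n). ?g m * ?g n) summable_on (- {(0, 0)})"
    by (rule summable_on_subset) auto
  then have sm: "(\<lambda>p. 4 * C ^ 3 * (case p of (m, n) \<Rightarrow> ?g m * ?g n)) summable_on (- {(0, 0)})"
    by (rule summable_on_cmult_right)
  show "(\<lambda>p. norm (case p of (m, n) \<Rightarrow> inverse ((of_int m * \<tau> + of_int n) ^ 6))) summable_on (- {(0, 0)})"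
  proof (rule Infinite_Sum.abs_summable_on_comparison_test'[OF sm])
    fix p :: "int \<times> int" assume p: "p \<in> - {(0, 0)}"
    obtain m n where mn: "p = (m, n)" by force
    let ?s = "(of_int m)\<^sup>2 + (of_int n)\<^sup>2 :: real" and ?w = "of_int m * \<tau> + of_int n"
    have "m\<^sup>2 + n\<^sup>2 \<noteq> 0" using p mn by (auto simp: sum_power2_eq_zero_iff)
    then have "m\<^sup>2 + n\<^sup>2 \<ge> 1" using sum_power2_ge_zero[of m n] by linarith
    then have s1: "?s \<ge> 1" by (metis of_int_1_le_iff of_int_add of_int_power)
    \<comment> \<open>With s = m^2 + n^2 >= 1 the product is at most 4 s^3, and s is at most C |m
      \<tau> + n|^2. The point is a majorant that factors into one function of m and one of
      n.\<close>
    have "(1 + (of_int m)\<^sup>2) * (1 + (of_int n)\<^sup>2) \<le> (1 + ?s) * (1 + ?s)" by (intro mult_mono) auto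
    also have "\<dots> \<le> (2 * ?s) * (2 * ?s)" using s1 by (intro mult_mono) auto
    also have "\<dots> = 4 * ?s ^ 2 * 1" by algebra
    also have "\<dots> \<le> 4 * ?s ^ 2 * ?s" using s1 by (intro mult_left_mono) auto
    also have "\<dots> = 4 * ?s ^ 3" by (simp add: eval_nat_numeral)
    also have "\<dots> \<le> 4 * (C * (norm ?w)\<^sup>2) ^ 3"
      using C(2)[of "of_int m" "of_int n"] by (intro mult_left_mono power_mono) auto
    finally have le: "(1 + (of_int m)\<^sup>2) * (1 + (of_int n)\<^sup>2) \<le> 4 * C ^ 3 * norm ?w ^ 6"
      by (simp add: power_mult_distrib flip: power_mult)
    have pos: "0 < (1 + (of_int m)\<^sup>2) * (1 + (of_int n)\<^sup>2 :: real)"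
      by (intro mult_pos_pos add_pos_nonneg) auto
    then have "0 < 4 * C ^ 3 * norm ?w ^ 6" using le by linarith
    then have "norm ?w ^ 6 > 0" using C(1) by (simp add: zero_less_mult_iff)
    with le pos have "inverse (norm ?w ^ 6) \<le>
        4 * C ^ 3 * inverse ((1 + (of_int m)\<^sup>2) * (1 + (of_int n)\<^sup>2))"
      using pos_le_divide_eq by (simp add: inverse_eq_divide pos_divide_le_eq del: mult_pos_pos)
    then show "norm (case p of (m, n) \<Rightarrow> inverse ((of_int m * \<tau> + of_int n) ^ 6)) \<le>
        4 * C ^ 3 * (case p of (m, n) \<Rightarrow> ?g m * ?g n)"
      unfolding mn split norm_inverse norm_power by (simp only: inverse_mult_distrib)
  qed
qed

text \<open>Unconditional summability allows the same double series to be evaluated both by rows m,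
  as Lipschitz series, and along m k = N, as the divisor sum series.\<close>

lemma has_sum_double_power_series:
  fixes q :: complex
  assumes "norm q < 1"
  shows "\<exists>S. ((\<lambda>(m, k). of_nat k ^ 5 * q ^ (m * k)) has_sum S) ({1..} \<times> {1..})"
proof -
  let ?r = "norm q"
  have "(\<lambda>k. of_nat k ^ 5 * of_real ?r ^ k :: complex) summable_on UNIV"
  proof (rule norm_summable_imp_summable_on)
    have "summable (\<lambda>k. norm (of_nat k ^ 5 * of_real ?r ^ k :: complex))"
      by (rule powser_insidea[where x = "of_real ((1 + ?r) / 2)"])
         (use summable_power_times_geometric[of "of_real ((1 + ?r) / 2)" 5] assms in
            \<open>auto simp: norm_mult norm_power simp del: of_real_add of_real_divide\<close>)
    then show "summable (\<lambda>k. norm (of_nat k ^ 5 * of_real ?r ^ k :: complex))" .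
  qed
  then have "(\<lambda>k. norm (of_nat k ^ 5 * of_real ?r ^ k :: complex)) summable_on UNIV"
    by (simp only: summable_on_iff_abs_summable_on_complex)
  then have "(\<lambda>k. real k ^ 5 * ?r ^ k) summable_on UNIV"
    by (simp add: norm_mult norm_power)
  then have "(\<lambda>k. real k ^ 5 * ?r ^ k) summable_on {1..}"
    by (rule summable_on_subset) auto
  moreover have "(\<lambda>m. ?r ^ (m - 1)) summable_on {1..}"
  proof -
    have "(\<lambda>m. ?r ^ m) summable_on UNIV"
      using assms by (intro summable_nonneg_imp_summable_on summable_geometric) auto
    then show ?thesis
      by (rule summable_on_reindex_bij_witness[of _ "\<lambda>m. m - 1" "\<lambda>m. m + 1", THEN iffD1, rotated -1]) auto
  qed
  ultimately have "(\<lambda>(m, k). ?r ^ (m - 1) * (real k ^ 5 * ?r ^ k)) summable_on {1..} \<times> {1..}"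
    by (intro summable_on_product_nonneg) auto
  then have "(\<lambda>p. norm ((\<lambda>(m, k). of_nat k ^ 5 * q ^ (m * k)) p)) summable_on ({1..} \<times> {1..})"
  proof (rule Infinite_Sum.abs_summable_on_comparison_test')
    fix p :: "nat \<times> nat" assume p: "p \<in> {1..} \<times> {1..}"
    then obtain m k where mk: "p = (Suc m, Suc k)"
      by (metis SigmaE atLeast_iff not0_implies_Suc not_one_le_zero)
    \<comment> \<open>For positive factors, m k >= (m - 1) + k; this separates the
      variables.\<close>
    have "?r ^ (Suc m * Suc k) \<le> ?r ^ (m + Suc k)"
      by (rule power_decreasing) (use assms in auto)
    then have "?r ^ (Suc m * Suc k) \<le> ?r ^ m * ?r ^ Suc k" by (simp only: power_add)
    then have "real (Suc k) ^ 5 * ?r ^ (Suc m * Suc k) \<le> real (Suc k) ^ 5 * (?r ^ m * ?r ^ Suc k)"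
      by (rule mult_left_mono) simp
    then show "norm ((\<lambda>(m, k). of_nat k ^ 5 * q ^ (m * k)) p) \<le>
        (case p of (m, k) \<Rightarrow> ?r ^ (m - 1) * (real k ^ 5 * ?r ^ k))"
      unfolding mk split norm_mult norm_power norm_of_nat by (simp only: diff_Suc_1 mult.left_commute)
  qed
  then show ?thesis using abs_summable_summable has_sum_infsum by blast
qed

lemma has_sum_lipschitz_series:
  assumes "Im z > 0"
  shows "((\<lambda>k. of_nat k ^ 5 * exp (2 * of_real pi * \<i> * z) ^ k) has_sum lipschitz_series 5 z) {1..}"
proof -
  have q: "norm (exp (2 * of_real pi * \<i> * z)) < 1"
    unfolding norm_exp_2pi_i using assms by simp
  have "((\<lambda>k. of_nat k ^ 5 * exp (2 * of_real pi * \<i> * z) ^ k) has_sum lipschitz_series 5 z) UNIV"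
    unfolding lipschitz_series_def
  proof (rule norm_summable_imp_has_sum[OF _ summable_sums[OF summable_power_times_geometric[OF q]]])
    obtain x where x: "norm (exp (2 * of_real pi * \<i> * z)) < x" "x < 1" using dense[OF q] by blast
    have "0 \<le> x" using x(1) norm_ge_zero[of "exp (2 * of_real pi * \<i> * z)"] by linarith
    then have n: "norm (of_real x :: complex) = x" by simp
    then show "summable (\<lambda>k. norm (of_nat k ^ 5 * exp (2 * of_real pi * \<i> * z) ^ k))"
      using x by (intro powser_insidea[OF summable_power_times_geometric[of "of_real x"]]) (simp_all only: n)
  qed
  then show ?thesis
    by (rule has_sum_cong_neutral[THEN iffD1, rotated -1]) auto
qed

text \<open>Pairs (m, k) are grouped by N = m k; in each group k runs through the divisors of
  N.\<close>

lemma divisor_sigma_sums: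
  fixes q :: complex
  assumes "((\<lambda>(m, k). of_nat k ^ 5 * q ^ (m * k)) has_sum S) ({1..} \<times> {1..})"
  shows "(\<lambda>k. of_nat (divisor_sigma 5 (Suc k)) * q ^ Suc k) sums S"
proof -
  have "((\<lambda>(N, d). of_nat d ^ 5 * q ^ N) has_sum S) (Sigma {1..} (\<lambda>N. {d. d dvd N}))"
    using assms
    by (rule has_sum_reindex_bij_witness[of _ "\<lambda>(N, d). (N div d, d)" "\<lambda>(m, k). (m * k, k)", THEN iffD1, rotated -1])
       (auto simp: dvd_div_eq_0_iff Suc_le_eq intro!: Nat.gr0I)
  then have "((\<lambda>N. of_nat (divisor_sigma 5 N) * q ^ N) has_sum S) {1..}"
  proof (rule has_sum_SigmaD)
    fix N :: nat assume "N \<in> {1..}"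
    then show "((\<lambda>d. case (N, d) of (N, d) \<Rightarrow> of_nat d ^ 5 * q ^ N) has_sum of_nat (divisor_sigma 5 N) * q ^ N) {d. d dvd N}"
      by (intro has_sum_finiteI) (auto simp: divisor_sigma_def sum_distrib_right)
  qed
  then have "((\<lambda>k. of_nat (divisor_sigma 5 (Suc k)) * q ^ Suc k) has_sum S) UNIV"
    by (rule has_sum_reindex_bij_witness[of _ Suc "\<lambda>n. n - 1", THEN iffD1, rotated -1]) auto
  then show ?thesis by (rule has_sum_imp_sums)
qed

text \<open>The row m = 0 is 2 \<zeta>(6); the rows m and - m are equal, by n -> - n, and are given
  by Lipschitz's formula. The coefficient is 504 = 2 (8/15) / (2/945).\<close>

lemma lattice_sum6_eq_E6:
  assumes "Im \<tau> > 0"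
  shows "lattice_sum6 \<tau> = 2 * of_real pi ^ 6 / 945 * E6 \<tau>"
proof -
  let ?f = "\<lambda>(m, n). inverse ((of_int m * \<tau> + of_int n) ^ 6)"
  let ?K = "- 8 * of_real pi ^ 6 / 15 :: complex"
  let ?P = "lipschitz_series 5"
  let ?g = "\<lambda>m :: int. if m = 0 then 2 * of_real pi ^ 6 / 945 else ?K * ?P (of_int \<bar>m\<bar> * \<tau>)"
  have Un: "- {(0, 0)} = Sigma UNIV (\<lambda>m::int. if m = 0 then - {0::int} else UNIV)" by (auto split: if_splits)
  have pos: "Im (of_int m * \<tau>) > 0" if "m > 0" for m using that assms by simp
  have "(?g has_sum lattice_sum6 \<tau>) UNIV"
    using has_sum_lattice_sum6[OF assms] unfolding Un
  proof (rule has_sum_SigmaD)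
    fix m :: int
    consider "m = 0" | "m > 0" | "m < 0" by linarith
    then show "((\<lambda>n. ?f (m, n)) has_sum ?g m) (if m = 0 then - {0} else UNIV)"
    proof cases
      case 1
      then show ?thesis using zeta6 by simp
    next
      case 2
      then show ?thesis using has_sum_inverse_power6_lipschitz[OF pos[OF 2]] by simp
    next
      case 3
      have "((\<lambda>n. inverse ((of_int (- m) * \<tau> + of_int n) ^ 6)) has_sum ?K * ?P (of_int (- m) * \<tau>)) UNIV"
        using has_sum_inverse_power6_lipschitz[OF pos[of "- m"]] 3 by simp
      then have "((\<lambda>n. ?f (m, n)) has_sum ?K * ?P (of_int (- m) * \<tau>)) UNIV"
      proof (rule has_sum_reindex_bij_witness[of _ uminus uminus, THEN iffD1, rotated -1])
        fix n :: int
        have "of_int m * \<tau> + of_int (- n) = - (of_int (- m) * \<tau> + of_int n)" by simp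
        then show "(case (m, - n) of (m, n) \<Rightarrow> inverse ((of_int m * \<tau> + of_int n) ^ 6)) =
            inverse ((of_int (- m) * \<tau> + of_int n) ^ 6)"
          by (simp only: split power_minus_even even_numeral)
      qed auto
      then show ?thesis using 3 by simp
    qed
  qed
  then have total: "(?g has_sum lattice_sum6 \<tau> - ?g 0) (UNIV - {0})"
    by (intro has_sum_Diff) (auto intro!: has_sum_finiteI)
  obtain S where S: "((\<lambda>(m, k). of_nat k ^ 5 * exp (2 * of_real pi * \<i> * \<tau>) ^ (m * k)) has_sum S) ({1..} \<times> {1..})"
    using has_sum_double_power_series[of "exp (2 * of_real pi * \<i> * \<tau>)"] assms
    unfolding norm_exp_2pi_i by auto
  have PS: "((\<lambda>m. ?P (of_nat m * \<tau>)) has_sum S) {1..}"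
    using S
  proof (rule has_sum_SigmaD)
    fix m :: nat assume m: "m \<in> {1..}"
    have "exp (2 * of_real pi * \<i> * (of_nat m * \<tau>)) = exp (2 * of_real pi * \<i> * \<tau>) ^ m"
      by (subst exp_of_nat_mult[symmetric]) (simp add: mult_ac)
    then show "((\<lambda>k. case (m, k) of (m, k) \<Rightarrow> of_nat k ^ 5 * exp (2 * of_real pi * \<i> * \<tau>) ^ (m * k))
        has_sum ?P (of_nat m * \<tau>)) {1..}"
      using has_sum_lipschitz_series[of "of_nat m * \<tau>"] m assms by (simp add: power_mult)
  qed
  then have KS: "((\<lambda>m. ?K * ?P (of_nat m * \<tau>)) has_sum ?K * S) {1..}" by (rule has_sum_cmult_right)
  have "(?g has_sum ?K * S) {0<..}"
    using KS by (rule has_sum_reindex_bij_witness[of _ nat int, THEN iffD1, rotated -1]) auto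
  moreover have "(?g has_sum ?K * S) {..<0}"
    using KS by (rule has_sum_reindex_bij_witness[of _ "\<lambda>m. nat (- m)" "\<lambda>m. - int m", THEN iffD1, rotated -1]) auto
  ultimately have "(?g has_sum ?K * S + ?K * S) ({0<..} \<union> {..<0})"
    by (intro has_sum_Un_disjoint) auto
  also have "{0<..} \<union> {..<0} = UNIV - {0::int}" by auto
  finally have eq: "lattice_sum6 \<tau> - ?g 0 = ?K * S + ?K * S" by (rule has_sum_unique[OF total])
  have E: "E6 \<tau> = 1 - 504 * S"
    using divisor_sigma_sums[OF S] unfolding E6_def by (simp add: sums_iff)
  have "2 * of_real pi ^ 6 / 945 * E6 \<tau> = 2 * of_real pi ^ 6 / 945 + (?K * S + ?K * S)"
    unfolding E by (simp add: field_simps)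
  moreover have "lattice_sum6 \<tau> = 2 * of_real pi ^ 6 / 945 + (?K * S + ?K * S)"
    using eq unfolding diff_eq_eq by (simp only: add.commute if_True refl)
  ultimately show ?thesis by (simp only:)
qed

section \<open>Moebius transformations and the weight 6 transformation law\<close>

lemma moebius_denominator_nonzero:
  fixes c d :: int
  assumes "Im \<tau> > 0" "a * d - b * c = 1"
  shows "of_int c * \<tau> + of_int d \<noteq> 0"
proof
  assume "of_int c * \<tau> + of_int d = 0"
  then have "Im (of_int c * \<tau> + of_int d) = 0" "Re (of_int c * \<tau> + of_int d) = 0" by (simp_all only: zero_complex.sel)
  then have "c = 0" "d = 0" using assms(1) by auto
  then show False using assms(2) by simp
qed

lemma Im_moebius:
  fixes a b c d :: real
  assumes "a * d - b * c = 1"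
  shows "Im ((of_real a * \<tau> + of_real b) / (of_real c * \<tau> + of_real d)) =
    Im \<tau> / (cmod (of_real c * \<tau> + of_real d))\<^sup>2"
proof -
  have "a * Im \<tau> * (c * Re \<tau> + d) - (a * Re \<tau> + b) * (c * Im \<tau>) = Im \<tau> * (a * d - b * c)" by algebra
  then show ?thesis using assms by (simp add: Im_divide cmod_power2)
qed

lemma Im_moebius_pos:
  fixes a b c d :: int
  assumes "Im \<tau> > 0" "a * d - b * c = 1"
  shows "Im ((of_int a * \<tau> + of_int b) / (of_int c * \<tau> + of_int d)) > 0"
proof -
  have "real_of_int a * real_of_int d - real_of_int b * real_of_int c = 1"
    using assms(2) by (metis of_int_1 of_int_diff of_int_mult)
  from Im_moebius[OF this, of \<tau>] moebius_denominator_nonzero[OF assms] assms(1)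
  show ?thesis by simp
qed

text \<open>Clearing the denominator turns (m, n) into the row vector times the matrix. As the
  determinant is 1, \<open>?h\<close> permutes the nonzero pairs, with inverse
  \<open>?i\<close>.\<close>

lemma lattice_sum6_modular:
  fixes a b c d :: int
  assumes "Im \<tau> > 0" "a * d - b * c = 1"
  defines "j \<equiv> of_int c * \<tau> + of_int d"
  shows "lattice_sum6 ((of_int a * \<tau> + of_int b) / j) = j ^ 6 * lattice_sum6 \<tau>"
proof -
  have j: "j \<noteq> 0" unfolding j_def by (rule moebius_denominator_nonzero[OF assms(1,2)])
  let ?f = "\<lambda>\<tau> (m, n). inverse ((of_int m * \<tau> + of_int n) ^ 6)"
  let ?h = "\<lambda>(m, n). (m * a + n * c, m * b + n * d)"
  let ?i = "\<lambda>(m, n). (m * d - n * c, n * a - m * b)"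
  have ih: "?i (?h p) = p" for p
  proof -
    obtain m n where p: "p = (m, n)" by force
    have "(m * a + n * c) * d - (m * b + n * d) * c = m * (a * d - b * c)"
      "(m * b + n * d) * a - (m * a + n * c) * b = n * (a * d - b * c)" by algebra+
    then show ?thesis unfolding p assms(2) by simp
  qed
  have hi: "?h (?i p) = p" for p
  proof -
    obtain m n where p: "p = (m, n)" by force
    have "(m * d - n * c) * a + (n * a - m * b) * c = m * (a * d - b * c)"
      "(m * d - n * c) * b + (n * a - m * b) * d = n * (a * d - b * c)" by algebra+
    then show ?thesis unfolding p assms(2) by simp
  qed
  have bij: "bij_betw ?h (- {(0, 0)}) (- {(0, 0)})"
  proof (rule bij_betwI[of _ _ _ ?i])
    show "?h \<in> - {(0, 0)} \<rightarrow> - {(0, 0)}"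
    proof
      fix p :: "int \<times> int" assume "p \<in> - {(0, 0)}"
      moreover have "?h p = (0, 0) \<Longrightarrow> p = (0, 0)" using ih[of p] by simp
      ultimately show "?h p \<in> - {(0, 0)}" by blast
    qed
    show "?i \<in> - {(0, 0)} \<rightarrow> - {(0, 0)}"
    proof
      fix p :: "int \<times> int" assume "p \<in> - {(0, 0)}"
      moreover have "?i p = (0, 0) \<Longrightarrow> p = (0, 0)" using hi[of p] by simp
      ultimately show "?i p \<in> - {(0, 0)}" by blast
    qed
  qed (use ih hi in auto)
  have "lattice_sum6 ((of_int a * \<tau> + of_int b) / j) = infsum (\<lambda>p. j ^ 6 * ?f \<tau> (?h p)) (- {(0, 0)})"
    unfolding lattice_sum6_def
  proof (rule infsum_cong)
    fix p :: "int \<times> int"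
    obtain m n where p: "p = (m, n)" by force
    have "of_int m * ((of_int a * \<tau> + of_int b) / j) + of_int n =
        (of_int (m * a + n * c) * \<tau> + of_int (m * b + n * d)) / j"
      using j by (simp add: field_simps) (simp add: j_def algebra_simps)
    then show "?f ((of_int a * \<tau> + of_int b) / j) p = j ^ 6 * ?f \<tau> (?h p)"
      unfolding p split by (simp only: power_divide inverse_divide) (simp only: divide_inverse)
  qed
  also have "\<dots> = j ^ 6 * infsum (\<lambda>p. ?f \<tau> (?h p)) (- {(0, 0)})" by (rule infsum_cmult_right')
  also have "infsum (\<lambda>p. ?f \<tau> (?h p)) (- {(0, 0)}) = lattice_sum6 \<tau>"
    unfolding lattice_sum6_def by (rule infsum_reindex_bij_betw[OF bij])
  finally show ?thesis .
qed

lemma E6_modular: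
  fixes a b c d :: int
  assumes "Im \<tau> > 0" "a * d - b * c = 1"
  shows "E6 ((of_int a * \<tau> + of_int b) / (of_int c * \<tau> + of_int d)) =
    (of_int c * \<tau> + of_int d) ^ 6 * E6 \<tau>"
proof -
  let ?j = "of_int c * \<tau> + of_int d"
  have "Im ((of_int a * \<tau> + of_int b) / ?j) > 0" by (rule Im_moebius_pos[OF assms])
  from lattice_sum6_eq_E6[OF this] lattice_sum6_modular[OF assms]
  have "2 * of_real pi ^ 6 / 945 * E6 ((of_int a * \<tau> + of_int b) / ?j) =
      2 * of_real pi ^ 6 / 945 * (?j ^ 6 * E6 \<tau>)"
    unfolding lattice_sum6_eq_E6[OF assms(1)] by (simp only: mult_ac)
  moreover have "2 * of_real pi ^ 6 / 945 \<noteq> (0 :: complex)" by simp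
  ultimately show ?thesis by (metis mult_left_cancel)
qed

section \<open>Estimates from the \<open>q\<close>-expansion\<close>

text \<open>The ratio (j + a + 1) / (j + a) is largest at j = 0, so one check there converts
  polynomial growth of coefficients into a geometric majorant.\<close>

lemma power_growth:
  fixes a j p r :: nat
  assumes "a > 0" "(a + 1) ^ p \<le> r * a ^ p"
  shows "(j + a) ^ p \<le> a ^ p * r ^ j"
proof (induction j)
  case (Suc j)
  have "(Suc j + a) * a \<le> (a + 1) * (j + a)" by (simp add: algebra_simps)
  then have "((Suc j + a) * a) ^ p \<le> ((a + 1) * (j + a)) ^ p" by (rule power_mono) simp
  then have "(Suc j + a) ^ p * a ^ p \<le> (a + 1) ^ p * (j + a) ^ p" by (simp only: power_mult_distrib)
  also have "\<dots> \<le> (r * a ^ p) * (a ^ p * r ^ j)" using assms Suc by (intro mult_mono) auto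
  finally have "(Suc j + a) ^ p * a ^ p \<le> (a ^ p * r ^ Suc j) * a ^ p" by (simp only: power_Suc mult_ac)
  then show ?case using assms(1) by simp
qed simp

lemma divisor_sigma5_le: "divisor_sigma 5 k \<le> k ^ 6"
proof (cases "k = 0")
  case False
  have "divisor_sigma 5 k \<le> (\<Sum>d | d dvd k. k ^ 5)"
    unfolding divisor_sigma_def using False by (intro sum_mono power_mono) (auto dest: dvd_imp_le)
  also have "\<dots> = card {d. d dvd k} * k ^ 5" by simp
  also have "\<dots> \<le> card {1..k} * k ^ 5"
    using False by (intro mult_right_mono card_mono) (auto dest: dvd_imp_le intro!: Suc_leI Nat.gr0I)
  also have "\<dots> = k ^ 6" by (simp add: eval_nat_numeral)
  finally show ?thesis .
qed (simp add: divisor_sigma_def)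

lemma divisor_sigma5_small:
  "divisor_sigma 5 0 = 0" "divisor_sigma 5 1 = 1" "divisor_sigma 5 2 = 33" "divisor_sigma 5 3 = 244"
proof -
  \<comment> \<open>Every natural number divides 0, and a sum over an infinite set is 0 by
    convention. This gives a power series starting at index 0 without a constant term.\<close>
  show "divisor_sigma 5 0 = 0" by (simp add: divisor_sigma_def)
  have "{d::nat. d dvd 1} = {1}" by auto
  then show "divisor_sigma 5 1 = 1" by (simp add: divisor_sigma_def)
  have "d = 1 \<or> d = 2" if "d dvd 2" for d :: nat
    using that two_is_prime_nat by (simp add: prime_nat_iff)
  then have "{d::nat. d dvd 2} = {1, 2}" by auto
  then show "divisor_sigma 5 2 = 33" by (simp add: divisor_sigma_def)
  have "d = 1 \<or> d = 3" if "d dvd 3" for d :: nat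
  proof -
    have "d \<le> 3" "d \<noteq> 0" using that dvd_imp_le[OF that] by (auto intro!: Nat.gr0I)
    moreover have "d \<noteq> 2" using that by auto
    ultimately show ?thesis by linarith
  qed
  then have "{d::nat. d dvd 3} = {1, 3}" by auto
  then show "divisor_sigma 5 3 = 244" by (simp add: divisor_sigma_def)
qed

text \<open>The j-th derivative, in the variable w = q, of the generating function of the divisor
  sums.\<close>

definition sigma_gf :: "nat \<Rightarrow> complex \<Rightarrow> complex" where
  "sigma_gf j w = (\<Sum>k. (diffs ^^ j) (\<lambda>k. of_nat (divisor_sigma 5 k)) k * w ^ k)"

lemma summable_sigma_gf:
  assumes "norm w < 1"
  shows "summable (\<lambda>k. (diffs ^^ j) (\<lambda>k. of_nat (divisor_sigma 5 k)) k * w ^ k :: complex)"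
  using assms
proof (induction j arbitrary: w)
  case 0
  obtain x where x: "norm w < x" "x < 1" using dense[OF 0] by blast
  have "0 \<le> x" using x(1) norm_ge_zero[of w] by linarith
  then have n: "norm (of_real x :: complex) = x" by simp
  have "summable (\<lambda>k. norm (of_nat k ^ 6 * w ^ k))"
    using x by (intro powser_insidea[OF summable_power_times_geometric[of "of_real x"]]) (simp_all only: n)
  then have "summable (\<lambda>k. of_nat (divisor_sigma 5 k) * w ^ k)"
  proof (rule summable_comparison_test'[of _ 0])
    fix k
    have "real (divisor_sigma 5 k) \<le> real k ^ 6"
      using divisor_sigma5_le[of k] by (metis of_nat_le_iff of_nat_power)
    then show "norm (of_nat (divisor_sigma 5 k) * w ^ k) \<le> norm (of_nat k ^ 6 * w ^ k)"
      by (simp add: norm_mult norm_power mult_right_mono)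
  qed
  then show ?case by simp
next
  case (Suc j)
  then show ?case using termdiff_converges[OF Suc.prems] by simp
qed

lemma sigma_gf_deriv:
  assumes "norm w < 1"
  shows "(sigma_gf j has_field_derivative sigma_gf (Suc j) w) (at w)"
  unfolding sigma_gf_def[abs_def]
  using termdiffs_strong'[OF summable_sigma_gf assms, of j] by simp

lemma power_series_tail:
  fixes c :: "nat \<Rightarrow> complex"
  assumes "\<And>k. norm (c (k + n)) \<le> M * r ^ k" "r \<ge> 0" "r * norm w < 1" "summable (\<lambda>k. c k * w ^ k)"
  obtains t where "(\<Sum>k. c k * w ^ k) = (\<Sum>k<n. c k * w ^ k) + w ^ n * t" "norm t \<le> M / (1 - r * norm w)"
proof -
  have geo: "(\<lambda>k. M * (r * norm w) ^ k) sums (M * (1 / (1 - r * norm w)))"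
    using assms by (intro sums_mult geometric_sums) simp
  have le: "norm (c (k + n) * w ^ k) \<le> M * (r * norm w) ^ k" for k
    using mult_right_mono[OF assms(1)[of k], of "norm w ^ k"]
    by (simp add: norm_mult norm_power power_mult_distrib mult_ac)
  have sn: "summable (\<lambda>k. norm (c (k + n) * w ^ k))"
    by (rule summable_comparison_test'[OF sums_summable[OF geo], of 0]) (use le in auto)
  have "norm (\<Sum>k. c (k + n) * w ^ k) \<le> (\<Sum>k. norm (c (k + n) * w ^ k))" by (rule summable_norm[OF sn])
  also have "\<dots> \<le> M * (1 / (1 - r * norm w))"
    using suminf_le[OF le sn sums_summable[OF geo]] geo by (simp add: sums_iff)
  finally have "norm (\<Sum>k. c (k + n) * w ^ k) \<le> M / (1 - r * norm w)" by simp
  moreover have "(\<Sum>k. c k * w ^ k) = (\<Sum>k<n. c k * w ^ k) + w ^ n * (\<Sum>k. c (k + n) * w ^ k)"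
  proof -
    have "(\<Sum>k. c (k + n) * w ^ (k + n)) = (\<Sum>k. w ^ n * (c (k + n) * w ^ k))"
      by (intro suminf_cong) (simp add: power_add mult_ac)
    also have "\<dots> = w ^ n * (\<Sum>k. c (k + n) * w ^ k)"
      by (rule suminf_mult[OF summable_norm_cancel[OF sn]])
    finally show ?thesis using suminf_split_initial_segment[OF assms(4), of n] by simp
  qed
  ultimately show ?thesis using that by blast
qed

text \<open>From \<sigma>_5(k) <= k^6 the tail coefficients start below 3^6, 4^7 and 4^8 and grow at
  most by factors 6, 5 and 6. Dividing by 1 - 6 |w| or 1 - 5 |w| and rounding up gives 750, 16800
  and 67400.\<close>

lemma sigma_gf_approx:
  assumes "norm w \<le> 11 / 2500"
  obtains a b c where
    "sigma_gf 0 w = w + 33 * w ^ 2 + w ^ 3 * a" "norm a \<le> 750"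
    "sigma_gf 1 w = 1 + 66 * w + 732 * w ^ 2 + w ^ 3 * b" "norm b \<le> 16800"
    "sigma_gf 2 w = 66 + 1464 * w + w ^ 2 * c" "norm c \<le> 67400"
proof -
  have w1: "norm w < 1" using assms by simp
  have s: "divisor_sigma 5 (Suc 0) = 1" "divisor_sigma 5 (Suc (Suc 0)) = 33" "divisor_sigma 5 (Suc (Suc (Suc 0))) = 244"
    using divisor_sigma5_small by (simp_all add: numeral_2_eq_2 numeral_3_eq_3)
  have e3: "(\<Sum>k<3. f k) = f 0 + f (Suc 0) + f (Suc (Suc 0))" and e2: "(\<Sum>k<2. f k) = f 0 + f (Suc 0)"
    for f :: "nat \<Rightarrow> complex"
    by (simp_all add: numeral_3_eq_3 numeral_2_eq_2)
  have A: "norm ((diffs ^^ 0) (\<lambda>k. of_nat (divisor_sigma 5 k)) (k + 3) :: complex) \<le> 729 * 6 ^ k" for k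
  proof -
    have "divisor_sigma 5 (k + 3) \<le> (k + 3) ^ 6" by (rule divisor_sigma5_le)
    also have "\<dots> \<le> 3 ^ 6 * 6 ^ k" by (rule power_growth) simp_all
    finally have "real (divisor_sigma 5 (k + 3)) \<le> real (3 ^ 6 * 6 ^ k)" by (simp only: of_nat_le_iff)
    then show ?thesis by simp
  qed
  have B: "norm ((diffs ^^ 1) (\<lambda>k. of_nat (divisor_sigma 5 k)) (k + 3) :: complex) \<le> 16384 * 5 ^ k" for k
  proof -
    have "(k + 4) * divisor_sigma 5 (k + 4) \<le> (k + 4) * (k + 4) ^ 6"
      by (intro mult_left_mono divisor_sigma5_le) simp
    also have "\<dots> = (k + 4) ^ Suc 6" by (simp only: power_Suc)
    also have "\<dots> \<le> 4 ^ Suc 6 * 5 ^ k" by (rule power_growth) simp_all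
    finally have "real ((k + 4) * divisor_sigma 5 (k + 4)) \<le> real (4 ^ Suc 6 * 5 ^ k)" by (simp only: of_nat_le_iff)
    moreover have "(diffs ^^ 1) (\<lambda>k. of_nat (divisor_sigma 5 k)) (k + 3) = (of_nat ((k + 4) * divisor_sigma 5 (k + 4)) :: complex)"
      by (simp add: diffs_def numeral_eq_Suc algebra_simps)
    ultimately show ?thesis by (simp only: norm_of_nat) simp
  qed
  have C: "norm ((diffs ^^ 2) (\<lambda>k. of_nat (divisor_sigma 5 k)) (k + 2) :: complex) \<le> 65536 * 6 ^ k" for k
  proof -
    have "(k + 3) * ((k + 4) * divisor_sigma 5 (k + 4)) \<le> (k + 4) * ((k + 4) * (k + 4) ^ 6)"
      by (intro mult_mono divisor_sigma5_le) simp_all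
    also have "\<dots> = (k + 4) ^ Suc (Suc 6)" by (simp only: power_Suc)
    also have "\<dots> \<le> 4 ^ Suc (Suc 6) * 6 ^ k" by (rule power_growth) simp_all
    finally have "real ((k + 3) * ((k + 4) * divisor_sigma 5 (k + 4))) \<le> real (4 ^ Suc (Suc 6) * 6 ^ k)" by (simp only: of_nat_le_iff)
    moreover have "(diffs ^^ 2) (\<lambda>k. of_nat (divisor_sigma 5 k)) (k + 2) = (of_nat ((k + 3) * ((k + 4) * divisor_sigma 5 (k + 4))) :: complex)"
      by (simp add: diffs_def numeral_eq_Suc algebra_simps)
    ultimately show ?thesis by (simp only: norm_of_nat) simp
  qed
  have r6: "6 * norm w < 1" and r5: "5 * norm w < 1" using assms by simp_all
  obtain a where a: "sigma_gf 0 w = (\<Sum>k<3. (diffs ^^ 0) (\<lambda>k. of_nat (divisor_sigma 5 k)) k * w ^ k) + w ^ 3 * a"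
    "norm a \<le> 729 / (1 - 6 * norm w)"
    using power_series_tail[OF A _ r6 summable_sigma_gf[OF w1]] unfolding sigma_gf_def by auto
  obtain b where b: "sigma_gf 1 w = (\<Sum>k<3. (diffs ^^ 1) (\<lambda>k. of_nat (divisor_sigma 5 k)) k * w ^ k) + w ^ 3 * b"
    "norm b \<le> 16384 / (1 - 5 * norm w)"
    using power_series_tail[OF B _ r5 summable_sigma_gf[OF w1]] unfolding sigma_gf_def by auto
  obtain c where c: "sigma_gf 2 w = (\<Sum>k<2. (diffs ^^ 2) (\<lambda>k. of_nat (divisor_sigma 5 k)) k * w ^ k) + w ^ 2 * c"
    "norm c \<le> 65536 / (1 - 6 * norm w)"
    using power_series_tail[OF C _ r6 summable_sigma_gf[OF w1]] unfolding sigma_gf_def by auto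
  show ?thesis
  proof (rule that)
    show "sigma_gf 0 w = w + 33 * w ^ 2 + w ^ 3 * a" unfolding a(1)
      by (simp add: e3 s divisor_sigma5_small(1) numeral_2_eq_2)
    show "sigma_gf 1 w = 1 + 66 * w + 732 * w ^ 2 + w ^ 3 * b" unfolding b(1)
      by (simp add: e3 s diffs_def numeral_2_eq_2)
    show "sigma_gf 2 w = 66 + 1464 * w + w ^ 2 * c" unfolding c(1)
      by (simp add: e2 s diffs_def numeral_2_eq_2)
    show "norm a \<le> 750" by (rule order.trans[OF a(2)]) (use assms in \<open>simp add: field_simps\<close>)
    show "norm b \<le> 16800" by (rule order.trans[OF b(2)]) (use assms in \<open>simp add: field_simps\<close>)
    show "norm c \<le> 67400" by (rule order.trans[OF c(2)]) (use assms in \<open>simp add: field_simps\<close>)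
  qed
qed

lemma norm_le_intros:
  fixes x y :: complex
  shows "norm x \<le> a \<Longrightarrow> norm y \<le> b \<Longrightarrow> norm (x + y) \<le> a + b"
    and "norm x \<le> a \<Longrightarrow> norm y \<le> b \<Longrightarrow> norm (x - y) \<le> a + b"
    and "norm x \<le> a \<Longrightarrow> norm y \<le> b \<Longrightarrow> norm (x * y) \<le> a * b"
    and "norm x \<le> a \<Longrightarrow> norm (x ^ n) \<le> a ^ n"
    and "norm (numeral m :: complex) \<le> numeral m"
    and "norm (1 :: complex) \<le> 1"
  subgoal by (rule order.trans[OF norm_triangle_ineq]) simp
  subgoal by (rule order.trans[OF norm_triangle_ineq4]) simp
  subgoal unfolding norm_mult by (rule mult_mono) (auto intro: order.trans[OF norm_ge_zero])
  subgoal unfolding norm_power by (rule power_mono) auto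
  by simp_all

lemma quotient_expansion:
  fixes w :: complex
  assumes "E - (1 + a * w + b * w ^ 2) * B = w ^ 3 * N" "B \<noteq> 0" "w \<noteq> 0"
  shows "E / (w * B) - (1 / w + a + b * w) = w ^ 2 * N / B"
proof -
  have "E = (1 + a * w + b * w ^ 2) * B + w ^ 3 * N" using assms(1) by (simp add: algebra_simps)
  then show ?thesis using assms(2,3) by (simp add: field_simps power2_eq_square power3_eq_cube)
qed

text \<open>
  \<open>E / (w B)\<close> and \<open>E (B + w D) / (w B\<^sup>2)\<close> are, up to normalisation, the non-trivial parts of \<open>h\<close> and \<open>h'\<close>
  at \<open>q = w\<close>. The coefficients subtracted are those of their Laurent expansions.
\<close>

lemma sigma_gf_estimates:
  fixes w :: complex
  assumes "norm w \<le> 11 / 2500" "w \<noteq> 0"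
  defines "E \<equiv> 1 - 504 * sigma_gf 0 w" and "B \<equiv> sigma_gf 1 w" and "D \<equiv> sigma_gf 2 w"
  shows "B \<noteq> 0"
    and "norm (E / (w * B) - (1 / w + - 570 + 20256 * w)) \<le> 41"
    and "norm (E * (B + w * D) / (w * B ^ 2) - (1 / w + - 504 + - 20256 * w)) \<le> 160"
proof -
  obtain a b c where abc:
    "sigma_gf 0 w = w + 33 * w ^ 2 + w ^ 3 * a" "norm a \<le> 750"
    "sigma_gf 1 w = 1 + 66 * w + 732 * w ^ 2 + w ^ 3 * b" "norm b \<le> 16800"
    "sigma_gf 2 w = 66 + 1464 * w + w ^ 2 * c" "norm c \<le> 67400"
    using sigma_gf_approx[OF assms(1)] by metis
  note bounds = norm_le_intros assms(1) abc(2,4,6)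
  have "norm (66 * w + 732 * w ^ 2 + w ^ 3 * b) \<le> 31 / 100"
    by (rule order.trans, (rule bounds)+) (simp add: power_divide)
  moreover have "norm B \<ge> norm (1::complex) - norm (66 * w + 732 * w ^ 2 + w ^ 3 * b)"
    using norm_triangle_ineq2[of 1 "- (66 * w + 732 * w ^ 2 + w ^ 3 * b)"]
    unfolding norm_minus_cancel diff_minus_eq_add B_def abc(3) by (simp only: add.assoc)
  ultimately have nB: "norm B \<ge> 69 / 100" by simp
  then show B0: "B \<noteq> 0" by auto
  have "norm (w ^ 2 * (504 * a + b + 919656 + w * (14827392 - 570 * b) + 20256 * b * w ^ 2)) \<le> 69 / 100 * 41"
    by (rule order.trans, (rule bounds)+) (simp add: power_divide)
  also have "\<dots> \<le> norm B * 41" using nB by simp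
  finally have "norm (w ^ 2 * (504 * a + b + 919656 + w * (14827392 - 570 * b) + 20256 * b * w ^ 2) / B) \<le> 41"
    using B0 by (simp add: norm_divide field_simps)
  moreover have EB: "E - (1 + - 570 * w + 20256 * w ^ 2) * B =
      w ^ 3 * (- (504 * a + b + 919656 + w * (14827392 - 570 * b) + 20256 * b * w ^ 2))"
    unfolding E_def B_def abc by algebra
  have "E / (w * B) - (1 / w + - 570 + 20256 * w) =
      w ^ 2 * - (504 * a + b + 919656 + w * (14827392 - 570 * b) + 20256 * b * w ^ 2) / B"
    by (rule quotient_expansion[OF EB B0 assms(2)])
  ultimately show "norm (E / (w * B) - (1 / w + - 570 + 20256 * w)) \<le> 41"
    by (simp only: mult_minus_right norm_minus_cancel minus_divide_left[symmetric])
  \<comment> \<open>\<open>w ^ 3 * ?N\<close> is what is left of \<open>E * (B + w * D)\<close>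
    after the leading Laurent terms times \<open>B ^ 2\<close> are removed. It is bounded termwise,
    with |B| >= 69/100 for the denominator.\<close>
  let ?N = "(2208240 + c - b - 504 * a) + (129528720 + 372 * b - 504 * c - 66528 * a) * w
    + (2227271040 + 88944 * b - 16632 * c - 1106784 * a) * w ^ 2
    + (10853650944 + 3411648 * b - b ^ 2 - 504 * a * c - 504 * a * b) * w ^ 3
    + (29654784 * b + 504 * b ^ 2) * w ^ 4 + 20256 * b ^ 2 * w ^ 5"
  have "norm (w ^ 2 * ?N) \<le> (69 / 100) ^ 2 * 160"
    by (rule order.trans, (rule bounds)+) (simp add: power_divide)
  also have "\<dots> \<le> norm B ^ 2 * 160" using nB by (intro mult_right_mono power_mono) auto
  finally have "norm (w ^ 2 * ?N / B ^ 2) \<le> 160"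
    using B0 by (simp add: norm_divide norm_power field_simps)
  moreover have EB2: "E * (B + w * D) - (1 + - 504 * w + - 20256 * w ^ 2) * B ^ 2 = w ^ 3 * ?N"
    unfolding E_def B_def D_def abc by algebra
  have "E * (B + w * D) / (w * B ^ 2) - (1 / w + - 504 + - 20256 * w) = w ^ 2 * ?N / B ^ 2"
    by (rule quotient_expansion[OF EB2 _ assms(2)]) (simp add: B0)
  ultimately show "norm (E * (B + w * D) / (w * B ^ 2) - (1 / w + - 504 + - 20256 * w)) \<le> 160"
    by (simp only:)
qed

section \<open>\<open>E6\<close> and its derivative as functions of q\<close>

definition nome :: "complex \<Rightarrow> complex" where
  "nome \<tau> = exp (2 * of_real pi * \<i> * \<tau>)"

lemma norm_nome: "norm (nome \<tau>) = exp (- 2 * pi * Im \<tau>)"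
  unfolding nome_def by (rule norm_exp_2pi_i)

lemma nome_nonzero [simp]: "nome \<tau> \<noteq> 0"
  by (simp add: nome_def)

lemma norm_nome_less_1: "Im \<tau> > 0 \<Longrightarrow> norm (nome \<tau>) < 1"
  by (simp add: norm_nome)

lemma nome_deriv: "(nome has_field_derivative 2 * of_real pi * \<i> * nome \<tau>) (at \<tau>)"
  unfolding nome_def[abs_def] by (auto intro!: derivative_eq_intros)

lemma nome_polar: "nome \<tau> = of_real (norm (nome \<tau>)) * cis (2 * pi * Re \<tau>)"
proof -
  have "2 * of_real pi * \<i> * \<tau> = of_real (- 2 * pi * Im \<tau>) + \<i> * of_real (2 * pi * Re \<tau>)"
    by (simp add: complex_eq_iff)
  then show ?thesis unfolding norm_nome unfolding nome_def by (simp only: exp_add exp_of_real cis_conv_exp)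
qed

lemma E6_eq_sigma_gf:
  assumes "Im \<tau> > 0"
  shows "E6 \<tau> = 1 - 504 * sigma_gf 0 (nome \<tau>)"
proof -
  have "sigma_gf 0 (nome \<tau>) = (\<Sum>k. of_nat (divisor_sigma 5 (Suc k)) * nome \<tau> ^ Suc k)"
    unfolding sigma_gf_def using summable_sigma_gf[OF norm_nome_less_1[OF assms], of 0]
    by (subst suminf_split_head) (auto simp: divisor_sigma_def)
  then show ?thesis unfolding E6_def nome_def by simp
qed

lemma E6_has_derivative:
  assumes "Im \<tau> > 0"
  shows "(E6 has_field_derivative (- 1008 * of_real pi * \<i> * nome \<tau> * sigma_gf 1 (nome \<tau>))) (at \<tau>)"
proof -
  have "((\<lambda>\<tau>. 1 - 504 * sigma_gf 0 (nome \<tau>)) has_field_derivative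
      (- 1008 * of_real pi * \<i> * nome \<tau> * sigma_gf 1 (nome \<tau>))) (at \<tau>)"
    by (rule derivative_eq_intros DERIV_chain2[OF sigma_gf_deriv[OF norm_nome_less_1[OF assms]] nome_deriv] refl)+
       (simp add: mult_ac)
  then show ?thesis
    by (rule has_field_derivative_transform_within_open[of _ _ _ "{\<tau>. Im \<tau> > 0}"])
       (use assms E6_eq_sigma_gf in \<open>auto simp: open_halfspace_Im_gt\<close>)
qed

lemma deriv_E6: "Im \<tau> > 0 \<Longrightarrow> deriv E6 \<tau> = - 1008 * of_real pi * \<i> * nome \<tau> * sigma_gf 1 (nome \<tau>)"
  by (rule DERIV_imp_deriv[OF E6_has_derivative])

lemma E6_DERIV: "Im \<tau> > 0 \<Longrightarrow> (E6 has_field_derivative deriv E6 \<tau>) (at \<tau>)"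
  using E6_has_derivative deriv_E6 by metis

text \<open>Differentiating the weight 6 law leaves the extra term with \<open>E6\<close>. Because
  of it the modular group does not permute the critical points, and their number can depend on
  c.\<close>

lemma deriv_E6_modular:
  fixes a b c d :: int
  assumes "Im \<tau> > 0" "a * d - b * c = 1"
  defines "j \<equiv> of_int c * \<tau> + of_int d"
  shows "deriv E6 ((of_int a * \<tau> + of_int b) / j) = j ^ 7 * (j * deriv E6 \<tau> + 6 * of_int c * E6 \<tau>)"
proof -
  let ?g = "\<lambda>z. (of_int a * z + of_int b) / (of_int c * z + of_int d) :: complex"
  have j: "j \<noteq> 0" unfolding j_def by (rule moebius_denominator_nonzero[OF assms(1,2)])
  have det: "of_int a * of_int d - of_int b * of_int c = (1 :: complex)"
    using assms(2) by (metis of_int_1 of_int_diff of_int_mult)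
  have g': "(?g has_field_derivative (1 / j ^ 2)) (at \<tau>)"
  proof -
    have "(?g has_field_derivative ((of_int a * j - (of_int a * \<tau> + of_int b) * of_int c) / (j * j))) (at \<tau>)"
      using j unfolding j_def by (auto intro!: derivative_eq_intros)
    also have "of_int a * j - (of_int a * \<tau> + of_int b) * of_int c = of_int a * of_int d - of_int b * of_int c"
      unfolding j_def by (simp add: algebra_simps)
    finally show ?thesis unfolding det by (simp add: power2_eq_square)
  qed
  have Im: "Im (?g \<tau>) > 0" by (rule Im_moebius_pos[OF assms(1,2)])
  have "((\<lambda>z. E6 (?g z)) has_field_derivative (deriv E6 (?g \<tau>) * (1 / j ^ 2))) (at \<tau>)"
    by (rule DERIV_chain2[OF E6_DERIV[OF Im] g'])
  moreover have "((\<lambda>z. (of_int c * z + of_int d) ^ 6 * E6 z) has_field_derivative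
      (j ^ 5 * (j * deriv E6 \<tau> + 6 * of_int c * E6 \<tau>))) (at \<tau>)"
    unfolding j_def
    by (rule derivative_eq_intros E6_DERIV[OF assms(1)] refl)+ (simp add: eval_nat_numeral algebra_simps)
  then have "((\<lambda>z. E6 (?g z)) has_field_derivative
      (j ^ 5 * (j * deriv E6 \<tau> + 6 * of_int c * E6 \<tau>))) (at \<tau>)"
    by (rule has_field_derivative_transform_within_open[of _ _ _ "{\<tau>. Im \<tau> > 0}"])
       (use assms E6_modular[OF _ assms(2)] in \<open>auto simp: open_halfspace_Im_gt\<close>)
  ultimately have "deriv E6 (?g \<tau>) * (1 / j ^ 2) = j ^ 5 * (j * deriv E6 \<tau> + 6 * of_int c * E6 \<tau>)"
    by (rule DERIV_unique)
  then have "deriv E6 (?g \<tau>) = j ^ 2 * (j ^ 5 * (j * deriv E6 \<tau> + 6 * of_int c * E6 \<tau>))"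
    using j by (simp add: field_simps)
  then show ?thesis unfolding j_def by (simp only: mult.assoc[symmetric] power_add[symmetric]) simp
qed

lemma sigma_gf_cnj: "sigma_gf j (cnj w) = cnj (sigma_gf j w)" if "norm w < 1"
proof -
  have c: "cnj ((diffs ^^ j) (\<lambda>k. of_nat (divisor_sigma 5 k)) k) = (diffs ^^ j) (\<lambda>k. of_nat (divisor_sigma 5 k)) k" for k
    by (induction j arbitrary: k) (simp_all add: diffs_def)
  have "(\<lambda>k. cnj ((diffs ^^ j) (\<lambda>k. of_nat (divisor_sigma 5 k)) k * w ^ k)) sums cnj (sigma_gf j w)"
    using summable_sums[OF summable_sigma_gf[OF that, of j]] unfolding sigma_gf_def sums_cnj .
  then show ?thesis unfolding sigma_gf_def by (simp add: c sums_iff)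
qed

lemma nome_reflect: "nome (of_int n - cnj \<tau>) = cnj (nome \<tau>)"
proof -
  have "2 * of_real pi * \<i> * (of_int n - cnj \<tau>) = cnj (2 * of_real pi * \<i> * \<tau>) + 2 * of_int n * pi * \<i>"
    by (simp add: algebra_simps)
  then show ?thesis unfolding nome_def by (simp only: exp_add exp_cnj exp_integer_2pi[OF Ints_of_int] mult_1_right)
qed

text \<open>The q-coefficients are real. The sign of the derivative comes from the reflection
  reversing the real direction.\<close>

lemma E6_reflect:
  assumes "Im \<tau> > 0"
  shows "E6 (of_int n - cnj \<tau>) = cnj (E6 \<tau>)"
    and "deriv E6 (of_int n - cnj \<tau>) = - cnj (deriv E6 \<tau>)"
proof -
  have "Im (of_int n - cnj \<tau>) > 0" using assms by simp
  note E6_eq_sigma_gf[OF this] deriv_E6[OF this]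
  then show "E6 (of_int n - cnj \<tau>) = cnj (E6 \<tau>)"
    "deriv E6 (of_int n - cnj \<tau>) = - cnj (deriv E6 \<tau>)"
    unfolding nome_reflect sigma_gf_cnj[OF norm_nome_less_1[OF assms]]
      E6_eq_sigma_gf[OF assms] deriv_E6[OF assms] by simp_all
qed

lemma exp_1_ge: "exp 1 \<ge> (2.718 :: real)"
proof -
  have "2.718 \<le> 5837465777 / 2147483648 - inverse (2 ^ 32 :: real)" by simp
  also have "\<dots> \<le> exp 1" using e_approx_32 by linarith
  finally show ?thesis .
qed

lemma sqrt3_ge: "sqrt 3 \<ge> 1.732"
  by (rule real_le_rsqrt) (simp add: power2_eq_square)

lemma half_sqrt2_ge: "sqrt 2 / 2 \<ge> 0.7"
proof -
  have "sqrt 2 \<ge> 1.4" by (rule real_le_rsqrt) (simp add: power2_eq_square)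
  then show ?thesis by simp
qed

lemma norm_nome_le:
  assumes "Im \<tau> \<ge> sqrt 3 / 2"
  shows "norm (nome \<tau>) \<le> 11 / 2500"
proof -
  have "5.44 \<le> 3.141 * (1.732 :: real)" by simp
  also have "\<dots> \<le> pi * sqrt 3" using sqrt3_ge pi_approx by (intro mult_mono) auto
  also have "\<dots> = 2 * pi * (sqrt 3 / 2)" by simp
  also have "\<dots> \<le> 2 * pi * Im \<tau>" using assms by (intro mult_left_mono) auto
  finally have y: "5.44 \<le> 2 * pi * Im \<tau>" .
  \<comment> \<open>exp(\<pi> sqrt 3) is about 230.8, so the margin over 2500/11 is small. The
    exponent is split as 5 + 0.44: a power of e and a quadratic Taylor bound.\<close>
  have "exp (1::real) ^ 5 \<ge> 2.718 ^ 5" using exp_1_ge by (intro power_mono) auto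
  then have e5: "exp (5::real) \<ge> 2.718 ^ 5" by (simp add: exp_of_nat_mult[symmetric])
  have e44: "exp (0.44 :: real) \<ge> 1 + 0.44 + 0.44\<^sup>2 / 2" by (rule exp_lower_Taylor_quadratic) simp
  have "2500 / 11 \<le> (2.718 ^ 5) * (1 + 0.44 + 0.44\<^sup>2 / 2 :: real)" by (simp add: eval_nat_numeral)
  also have "\<dots> \<le> exp 5 * exp (0.44 :: real)" using e5 e44 by (intro mult_mono) auto
  also have "\<dots> = exp 5.44" by (subst exp_add[symmetric]) simp
  also have "\<dots> \<le> exp (2 * pi * Im \<tau>)" using y by simp
  finally have "exp (2 * pi * Im \<tau>) \<ge> 2500 / 11" .
  then have "inverse (exp (2 * pi * Im \<tau>)) \<le> inverse (2500 / 11)" by (intro le_imp_inverse_le) auto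
  then show ?thesis unfolding norm_nome by (simp add: exp_minus)
qed

section \<open>The equivariant map\<close>

text \<open>Division by zero gives the value \<tau> at a zero of \<open>deriv E6\<close>, where the
  true map has a pole or is undefined. Level arguments with this function therefore stay at height
  at least sqrt 3 / 2, where \<open>deriv E6\<close> does not vanish.\<close>

definition equivariant_map :: "complex \<Rightarrow> complex" where
  "equivariant_map \<tau> = \<tau> + 6 * E6 \<tau> / deriv E6 \<tau>"

context
  fixes \<tau> :: complex
  assumes Im_ge: "Im \<tau> \<ge> sqrt 3 / 2"
begin

lemma Im_pos: "Im \<tau> > 0"
proof -
  have "0 < sqrt 3 / (2::real)" by simp
  then show ?thesis using Im_ge by linarith
qed

lemma deriv_E6_nonzero: "deriv E6 \<tau> \<noteq> 0"
  using deriv_E6[OF Im_pos] sigma_gf_estimates(1)[OF norm_nome_le[OF Im_ge] nome_nonzero] by simp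

lemma equivariant_map_q_expansion:
  "equivariant_map \<tau> = \<tau> + \<i> / (168 * of_real pi) *
    ((1 - 504 * sigma_gf 0 (nome \<tau>)) / (nome \<tau> * sigma_gf 1 (nome \<tau>)))"
proof -
  have B: "sigma_gf 1 (nome \<tau>) \<noteq> 0" by (rule sigma_gf_estimates(1)[OF norm_nome_le[OF Im_ge] nome_nonzero])
  have "6 * E / (- 1008 * of_real pi * \<i> * q * B) = \<i> / (168 * of_real pi) * (E / (q * B))"
    if "q \<noteq> 0" "B \<noteq> 0" for E q B :: complex
    using that by (simp add: field_simps)
  from this[OF nome_nonzero B] show ?thesis
    unfolding equivariant_map_def deriv_E6[OF Im_pos] E6_eq_sigma_gf[OF Im_pos] by (simp only:)
qed

lemma equivariant_map_approx:
  obtains u where "equivariant_map \<tau> = \<tau> + \<i> / (168 * of_real pi) * (1 / nome \<tau> + - 570 + 20256 * nome \<tau> + u)"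
    "norm u \<le> 41"
  using equivariant_map_q_expansion sigma_gf_estimates(2)[OF norm_nome_le[OF Im_ge] nome_nonzero]
  by (metis add_diff_cancel_left' diff_add_cancel add.commute)

text \<open>The derivative is 7 - 6 E E'' / E'^2. Substituting the q-derivatives turns the second
  term into the quotient estimated before, with factor 1/84.\<close>

lemma equivariant_map_deriv:
  obtains v where "(equivariant_map has_field_derivative
      (7 + 1 / 84 * (1 / nome \<tau> + - 504 + - 20256 * nome \<tau> + v))) (at \<tau>)"
    "norm v \<le> 160"
proof -
  let ?q = "nome \<tau>"
  let ?E = "1 - 504 * sigma_gf 0 ?q" and ?B = "sigma_gf 1 ?q" and ?D = "sigma_gf 2 ?q"
  have q1: "norm ?q < 1" by (rule norm_nome_less_1[OF Im_pos])
  have B: "?B \<noteq> 0" by (rule sigma_gf_estimates(1)[OF norm_nome_le[OF Im_ge] nome_nonzero])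
  define v where "v = ?E * (?B + ?q * ?D) / (?q * ?B ^ 2) - (1 / ?q + - 504 + - 20256 * ?q)"
  have v: "norm v \<le> 160" unfolding v_def by (rule sigma_gf_estimates(3)[OF norm_nome_le[OF Im_ge] nome_nonzero])
  have dB: "((\<lambda>\<tau>. sigma_gf 1 (nome \<tau>)) has_field_derivative ?D * (2 * of_real pi * \<i> * ?q)) (at \<tau>)"
    using DERIV_chain2[OF sigma_gf_deriv[OF q1, of 1] nome_deriv] by (simp add: numeral_2_eq_2)
  have dE6': "((\<lambda>\<tau>. - 1008 * of_real pi * \<i> * nome \<tau> * sigma_gf 1 (nome \<tau>)) has_field_derivative
      - 1008 * of_real pi * \<i> * (2 * of_real pi * \<i> * ?q) * (?B + ?q * ?D)) (at \<tau>)"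
    by (rule derivative_eq_intros nome_deriv dB refl)+ (simp add: algebra_simps)
  have dE6: "(deriv E6 has_field_derivative
      - 1008 * of_real pi * \<i> * (2 * of_real pi * \<i> * ?q) * (?B + ?q * ?D)) (at \<tau>)"
    by (rule has_field_derivative_transform_within_open[OF dE6', of "{\<tau>. Im \<tau> > 0}"])
       (use Im_pos deriv_E6 in \<open>auto simp: open_halfspace_Im_gt\<close>)
  have D: "(equivariant_map has_field_derivative
      (1 + (6 * deriv E6 \<tau> * deriv E6 \<tau> -
        6 * E6 \<tau> * (- 1008 * of_real pi * \<i> * (2 * of_real pi * \<i> * ?q) * (?B + ?q * ?D)))
         / (deriv E6 \<tau> * deriv E6 \<tau>))) (at \<tau>)"
    unfolding equivariant_map_def[abs_def]
    by (rule derivative_eq_intros E6_DERIV[OF Im_pos] dE6 deriv_E6_nonzero refl)+ simp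
  have alg: "1 + (6 * (- 1008 * of_real pi * \<i> * q * B) * (- 1008 * of_real pi * \<i> * q * B) -
        6 * E * (- 1008 * of_real pi * \<i> * (2 * of_real pi * \<i> * q) * (B + q * D)))
         / ((- 1008 * of_real pi * \<i> * q * B) * (- 1008 * of_real pi * \<i> * q * B))
      = 7 + 1 / 84 * (E * (B + q * D) / (q * B ^ 2))" if "q \<noteq> 0" "B \<noteq> 0" for q B D E :: complex
  proof -
    have p: "of_real pi \<noteq> (0::complex)" by simp
    have K: "1 + (6 * K * K - X) / (K * K) = 7 - X / (K * K)" if "K \<noteq> 0" for K X :: complex
      using that by (simp add: field_simps)
    have "(- 1008 * of_real pi * \<i> * q * B) \<noteq> 0" using that by simp
    note K[OF this, of "6 * E * (- 1008 * of_real pi * \<i> * (2 * of_real pi * \<i> * q) * (B + q * D))"]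
    also have "6 * E * (- 1008 * of_real pi * \<i> * (2 * of_real pi * \<i> * q) * (B + q * D))
         / ((- 1008 * of_real pi * \<i> * q * B) * (- 1008 * of_real pi * \<i> * q * B)) =
        - (1 / 84 * (E * (B + q * D) / (q * B ^ 2)))"
      using that p by (simp add: divide_simps power2_eq_square)
    finally show ?thesis by simp
  qed
  have "(equivariant_map has_field_derivative (7 + 1 / 84 * (?E * (?B + ?q * ?D) / (?q * ?B ^ 2)))) (at \<tau>)"
    using D unfolding deriv_E6[OF Im_pos] E6_eq_sigma_gf[OF Im_pos] alg[OF nome_nonzero B] .
  then have "(equivariant_map has_field_derivative
      (7 + 1 / 84 * (1 / nome \<tau> + - 504 + - 20256 * nome \<tau> + v))) (at \<tau>)"
    unfolding v_def by (simp only: add_diff_cancel_left' diff_add_cancel add.commute[of _ "_ - _"])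
  then show ?thesis using v by (rule that)
qed

lemma nome_Re_Im:
  defines "t \<equiv> norm (nome \<tau>)" and "\<theta> \<equiv> 2 * pi * Re \<tau>"
  shows "Re (nome \<tau>) = t * cos \<theta>" "Im (nome \<tau>) = t * sin \<theta>"
    "Re (1 / nome \<tau>) = 1 / t * cos \<theta>" "Im (1 / nome \<tau>) = - (1 / t * sin \<theta>)"
proof -
  have n: "nome \<tau> = of_real t * cis \<theta>" unfolding t_def \<theta>_def by (rule nome_polar)
  have i: "1 / nome \<tau> = of_real (1 / t) * cis (- \<theta>)" unfolding n by (simp add: divide_inverse cis_inverse)
  show "Re (nome \<tau>) = t * cos \<theta>" "Im (nome \<tau>) = t * sin \<theta>" unfolding n by simp_all
  show "Re (1 / nome \<tau>) = 1 / t * cos \<theta>" "Im (1 / nome \<tau>) = - (1 / t * sin \<theta>)" unfolding i by simp_all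
qed

text \<open>The factor i exchanges the parts: with q = t exp(i \<theta>) the cosine governs the
  imaginary part and the sine the real part. So realness is decided near \<theta> = \<pi>/2, where
  the sine is large.\<close>

lemma equivariant_map_bounds:
  defines "t \<equiv> norm (nome \<tau>)" and "\<theta> \<equiv> 2 * pi * Re \<tau>"
  shows "\<bar>168 * pi * (Im (equivariant_map \<tau>) - Im \<tau>) - ((1 / t + 20256 * t) * cos \<theta> - 570)\<bar> \<le> 41"
    and "\<bar>168 * pi * (Re (equivariant_map \<tau>) - Re \<tau>) - (1 / t - 20256 * t) * sin \<theta>\<bar> \<le> 41"
proof -
  obtain u where u: "equivariant_map \<tau> = \<tau> + \<i> / (168 * of_real pi) * (1 / nome \<tau> + - 570 + 20256 * nome \<tau> + u)"
    "norm u \<le> 41" by (rule equivariant_map_approx)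
  let ?X = "1 / nome \<tau> + - 570 + 20256 * nome \<tau> + u"
  have "equivariant_map \<tau> - \<tau> = of_real (1 / (168 * pi)) * (\<i> * ?X)" unfolding u(1) by simp
  then have "Re (equivariant_map \<tau> - \<tau>) = 1 / (168 * pi) * (- Im ?X)" "Im (equivariant_map \<tau> - \<tau>) = 1 / (168 * pi) * Re ?X"
    by (simp_all only: Re_complex_of_real Im_complex_of_real complex.sel times_complex.sel minus_complex.sel) simp_all
  then have RI: "168 * pi * (Re (equivariant_map \<tau>) - Re \<tau>) = - Im ?X" "168 * pi * (Im (equivariant_map \<tau>) - Im \<tau>) = Re ?X"
    by (simp_all add: field_simps)
  have X: "Re ?X = 1 / t * cos \<theta> - 570 + 20256 * (t * cos \<theta>) + Re u"
    "Im ?X = - (1 / t * sin \<theta>) + 20256 * (t * sin \<theta>) + Im u"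
    using nome_Re_Im[folded t_def \<theta>_def] by simp_all
  have "\<bar>Re u\<bar> \<le> 41" "\<bar>Im u\<bar> \<le> 41" using u(2) abs_Re_le_cmod[of u] abs_Im_le_cmod[of u] by linarith+
  then show "\<bar>168 * pi * (Im (equivariant_map \<tau>) - Im \<tau>) - ((1 / t + 20256 * t) * cos \<theta> - 570)\<bar> \<le> 41"
    "\<bar>168 * pi * (Re (equivariant_map \<tau>) - Re \<tau>) - (1 / t - 20256 * t) * sin \<theta>\<bar> \<le> 41"
    unfolding RI X by (simp_all add: algebra_simps)
qed

lemma nome_numerics:
  defines "t \<equiv> norm (nome \<tau>)"
  shows "t > 0" "t \<le> 11 / 2500" "1 / t + 20256 * t \<ge> 280" "1 / t - 20256 * t \<ge> 100"
    "168 * pi * Im \<tau> \<ge> 456" "1 / t = exp (2 * pi * Im \<tau>)"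
proof -
  show t: "t > 0" by (simp add: t_def)
  show t2: "t \<le> 11 / 2500" unfolding t_def by (rule norm_nome_le[OF Im_ge])
  \<comment> \<open>Completing the square bounds the sum by 280 because 140^2 <= 20256.\<close>
  have "0 \<le> 20256 * (t - 140 / 20256)\<^sup>2" by simp
  then show "1 / t + 20256 * t \<ge> 280" using t by (simp add: field_simps power2_eq_square)
  have "1 / t \<ge> 1 / (11 / 2500)" using t t2 by (intro divide_left_mono) auto
  then show "1 / t - 20256 * t \<ge> 100" using t2 by simp
  show "1 / t = exp (2 * pi * Im \<tau>)" unfolding t_def norm_nome by (simp add: exp_minus field_simps)
  have "456 \<le> 84 * (3.141 * (1.732 :: real))" by simp
  also have "\<dots> \<le> 84 * (pi * sqrt 3)" using sqrt3_ge pi_approx by (intro mult_mono mult_left_mono) auto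
  also have "\<dots> = 168 * pi * (sqrt 3 / 2)" by simp
  also have "\<dots> \<le> 168 * pi * Im \<tau>" using Im_ge by (intro mult_left_mono) auto
  finally show "168 * pi * Im \<tau> \<ge> 456" .
qed

text \<open>The leading term is at least 0.7 * 280 = 196, which alone loses against 570 + 41. The
  summand \<tau> decides, since 456 + 196 > 611.\<close>

lemma Im_equivariant_map_pos:
  assumes "0 \<le> Re \<tau>" "Re \<tau> \<le> 1 / 8"
  shows "Im (equivariant_map \<tau>) > 0"
proof -
  let ?t = "norm (nome \<tau>)" and ?\<theta> = "2 * pi * Re \<tau>"
  have "cos (pi / 4) \<le> cos ?\<theta>"
    using assms by (intro cos_monotone_0_pi_le) (auto simp: field_simps)
  moreover note half_sqrt2_ge
  ultimately have c: "cos ?\<theta> \<ge> 0.7" by (simp add: cos_45)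
  have "280 * 0.7 \<le> (1 / ?t + 20256 * ?t) * cos ?\<theta>"
    using nome_numerics c by (intro mult_mono) auto
  then have "168 * pi * Im (equivariant_map \<tau>) > 0"
    using equivariant_map_bounds(1) nome_numerics(5) by (simp add: right_diff_distrib abs_le_iff)
  then show ?thesis by (simp add: zero_less_mult_iff)
qed

lemma Im_equivariant_map_neg:
  assumes "3 / 8 \<le> Re \<tau>" "Re \<tau> \<le> 1 / 2"
  shows "Im (equivariant_map \<tau>) < 0"
proof -
  let ?t = "norm (nome \<tau>)" and ?\<theta> = "2 * pi * Re \<tau>" and ?y = "2 * pi * Im \<tau>"
  have "cos ?\<theta> \<le> cos (pi - pi / 4)"
    using assms by (intro cos_monotone_0_pi_le) (auto simp: field_simps)
  moreover note half_sqrt2_ge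
  moreover have "cos (pi - pi / 4) = - (sqrt 2 / 2)" by (simp only: cos_pi_minus cos_45)
  ultimately have c: "cos ?\<theta> \<le> - 0.7" by linarith
  have "(1 / ?t + 20256 * ?t) * cos ?\<theta> \<le> (1 / ?t + 20256 * ?t) * (- 0.7)"
    using nome_numerics c by (intro mult_left_mono) auto
  also have "\<dots> \<le> - 0.7 * exp ?y" using nome_numerics(1,6) by simp
  finally have le: "(1 / ?t + 20256 * ?t) * cos ?\<theta> \<le> - 0.7 * exp ?y" .
  have "exp (1::real) ^ 5 \<ge> 2.7 ^ 5" using exp_1_ge by (intro power_mono) auto
  then have "exp (5::real) \<ge> 2.7 ^ 5" by (simp add: exp_of_nat_mult[symmetric])
  moreover have "143 \<le> (2.7 ^ 5 :: real)" by (simp add: eval_nat_numeral)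
  ultimately have e5: "exp (5::real) \<ge> 143" by linarith
  have y5: "?y \<ge> 5" using nome_numerics(5) by simp
  \<comment> \<open>Here \<open>168 * pi * Im \<tau>\<close>, which is \<open>84 * ?y\<close>, has
    the unfavourable sign. A line below \<open>exp\<close> through 5 suffices, as its slope
    satisfies 0.7 * 143 > 84.\<close>
  have "143 * (1 + (?y - 5)) \<le> exp 5 * exp (?y - 5)"
    using e5 y5 by (intro mult_mono exp_ge_add_one_self) auto
  also have "\<dots> = exp ?y" by (subst exp_add[symmetric]) simp
  finally have "exp ?y \<ge> 143 * (?y - 4)" by simp
  with le equivariant_map_bounds(1) y5 have "168 * pi * Im (equivariant_map \<tau>) < 0"
    by (simp add: right_diff_distrib abs_le_iff)
  then show ?thesis by (simp add: mult_less_0_iff)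
qed

lemma sin_ge_07:
  assumes "1 / 8 \<le> Re \<tau>" "Re \<tau> \<le> 3 / 8"
  shows "sin (2 * pi * Re \<tau>) \<ge> 0.7"
proof -
  have "pi * (1 / 8) \<le> pi * Re \<tau>" "pi * Re \<tau> \<le> pi * (3 / 8)"
    using assms by (auto intro!: mult_left_mono)
  then have "\<bar>pi / 2 - 2 * pi * Re \<tau>\<bar> \<le> pi / 4" by linarith
  then have "cos (pi / 4) \<le> cos \<bar>pi / 2 - 2 * pi * Re \<tau>\<bar>"
    by (intro cos_monotone_0_pi_le) auto
  moreover note half_sqrt2_ge
  ultimately show ?thesis by (simp add: cos_45 cos_diff)
qed

text \<open>The growth bound shows that arbitrarily large real levels are reached; positivity rules
  out the value -1 on the unit circle.\<close>

lemma Re_equivariant_map_pos: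
  assumes "1 / 8 \<le> Re \<tau>" "Re \<tau> \<le> 3 / 8"
  shows "168 * pi * Re (equivariant_map \<tau>) \<ge> 0.7 * (exp (2 * pi * Im \<tau>) - 90) - 41" and "Re (equivariant_map \<tau>) > 0"
proof -
  let ?t = "norm (nome \<tau>)"
  have "(1 / ?t - 20256 * ?t) * 0.7 \<le> (1 / ?t - 20256 * ?t) * sin (2 * pi * Re \<tau>)"
    using sin_ge_07[OF assms] nome_numerics by (intro mult_left_mono) auto
  moreover have "168 * pi * Re \<tau> \<ge> 0" using assms by simp
  ultimately have *: "168 * pi * Re (equivariant_map \<tau>) \<ge> (1 / ?t - 20256 * ?t) * 0.7 - 41"
    using equivariant_map_bounds(2)[unfolded right_diff_distrib abs_le_iff] by linarith
  have aux: "0.7 * (s - 90) - 41 \<le> z" if "(s - k) * 0.7 - 41 \<le> z" "k \<le> 90" for s k z :: real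
    using that by (simp add: field_simps)
  have "20256 * ?t \<le> 90" using nome_numerics(2) by simp
  with * show "168 * pi * Re (equivariant_map \<tau>) \<ge> 0.7 * (exp (2 * pi * Im \<tau>) - 90) - 41"
    unfolding nome_numerics(6)[symmetric] by (rule aux)
  have "z > 0" if "s * 0.7 - 41 \<le> z" "s \<ge> 100" for s z :: real
    using that by (simp add: field_simps)
  from this[OF * nome_numerics(4)] have "168 * pi * Re (equivariant_map \<tau>) > 0" .
  then show "Re (equivariant_map \<tau>) > 0" by (simp add: zero_less_mult_iff)
qed

lemma equivariant_map_deriv_Im_neg:
  assumes "1 / 8 \<le> Re \<tau>" "Re \<tau> \<le> 3 / 8"
  obtains d where "(equivariant_map has_field_derivative d) (at \<tau>)" "Im d < 0"
proof -
  obtain v where v: "(equivariant_map has_field_derivative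
      (7 + 1 / 84 * (1 / nome \<tau> + - 504 + - 20256 * nome \<tau> + v))) (at \<tau>)" "norm v \<le> 160"
    by (rule equivariant_map_deriv)
  let ?t = "norm (nome \<tau>)"
  \<comment> \<open>Both the 1/q term and the q term push the imaginary part down, together by at
    least 196, which exceeds the error 160.\<close>
  have "280 * 0.7 \<le> (1 / ?t + 20256 * ?t) * sin (2 * pi * Re \<tau>)"
    using sin_ge_07[OF assms] nome_numerics by (intro mult_mono) auto
  moreover have "Im v \<le> 160" using v(2) abs_Im_le_cmod[of v] by linarith
  ultimately have "Im (7 + 1 / 84 * (1 / nome \<tau> + - 504 + - 20256 * nome \<tau> + v)) < 0"
    using nome_Re_Im by (simp add: algebra_simps)
  then show ?thesis using v(1) that by blast
qed

end

section \<open>The curve where the equivariant map is real\<close>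

text \<open>The Noshiro-Warschawski argument: along the segment the imaginary part of f / (r - p)
  has derivative Im f', so the real mean value theorem applies.\<close>

lemma Im_difference_quotient_neg:
  assumes "convex S" "p \<in> S" "r \<in> S" "p \<noteq> r"
    and deriv: "\<And>z. z \<in> S \<Longrightarrow> \<exists>d. (f has_field_derivative d) (at z) \<and> Im d < 0"
  shows "Im ((f r - f p) / (r - p)) < 0"
proof -
  obtain f' where f': "\<And>z. z \<in> S \<Longrightarrow> (f has_field_derivative f' z) (at z)" "\<And>z. z \<in> S \<Longrightarrow> Im (f' z) < 0"
    using deriv by metis
  define l where "l = (\<lambda>t. p + of_real t * (r - p))"
  have l: "l t \<in> S" if "0 \<le> t" "t \<le> 1" for t
  proof -
    have "l t = (1 - t) *\<^sub>R p + t *\<^sub>R r" by (simp add: l_def scaleR_conv_of_real algebra_simps)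
    then show ?thesis using assms(1-3) that by (simp add: convexD_alt)
  qed
  have D: "((\<lambda>t. Im (f (l t) / (r - p))) has_real_derivative Im (f' (l t))) (at t)" if "0 \<le> t" "t \<le> 1" for t
  proof -
    have "(l has_vector_derivative (r - p)) (at t)"
      unfolding l_def by (auto intro!: derivative_eq_intros)
    then have "(f \<circ> l has_vector_derivative ((r - p) * f' (l t))) (at t)"
      using f'(1)[OF l[OF that]] by (rule field_vector_diff_chain_at)
    then have "((\<lambda>t. Im ((f \<circ> l) t / (r - p))) has_vector_derivative Im ((r - p) * f' (l t) / (r - p))) (at t)"
      by (intro bounded_linear.has_vector_derivative[OF bounded_linear_Im] has_vector_derivative_divide)
    then show ?thesis using assms(4)
      by (simp add: has_real_derivative_iff_has_vector_derivative)
  qed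
  have "\<exists>z. 0 < z \<and> z < 1 \<and> Im (f (l 1) / (r - p)) - Im (f (l 0) / (r - p)) = (1 - 0) * Im (f' (l z))"
    by (rule MVT2) (use D in auto)
  then obtain z where z: "0 < z" "z < 1" "Im (f (l 1) / (r - p)) - Im (f (l 0) / (r - p)) = Im (f' (l z))" by auto
  then have "Im (f r / (r - p)) - Im (f p / (r - p)) < 0"
    using f'(2)[OF l[of z]] by (simp add: l_def)
  then show ?thesis by (simp add: diff_divide_distrib)
qed

text \<open>Convex, so that difference quotients can be controlled. The lower edge lies below the
  arc of the unit circle, so the curve of real values can be followed across it.\<close>

definition curve_strip :: "complex set" where
  "curve_strip = {z. 1 / 8 \<le> Re z \<and> Re z \<le> 3 / 8 \<and> sqrt 3 / 2 \<le> Im z}"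

lemma convex_curve_strip: "convex curve_strip"
proof -
  have eq: "curve_strip = {z. Re z \<ge> 1 / 8} \<inter> {z. Re z \<le> 3 / 8} \<inter> {z. Im z \<ge> sqrt 3 / 2}"
    by (auto simp: curve_strip_def)
  show ?thesis unfolding eq
    by (intro convex_Int convex_halfspace_Re_ge convex_halfspace_Re_le convex_halfspace_Im_ge)
qed

text \<open>For a real increment x, Im (x / (r - p)) is - x (Im r - Im p) / |r - p|^2. Its
  negativity gives both monotonicity in the height and at most one real point on each horizontal
  line.\<close>

lemma real_level_increasing:
  assumes "p \<in> curve_strip" "r \<in> curve_strip" "p \<noteq> r"
    "Im (equivariant_map p) = 0" "Im (equivariant_map r) = 0"
  shows "(Re (equivariant_map r) - Re (equivariant_map p)) * (Im r - Im p) > 0"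
proof -
  have "Im ((equivariant_map r - equivariant_map p) / (r - p)) < 0"
  proof (rule Im_difference_quotient_neg[OF convex_curve_strip assms(1,2,3)])
    fix z assume "z \<in> curve_strip"
    then show "\<exists>d. (equivariant_map has_field_derivative d) (at z) \<and> Im d < 0"
      using equivariant_map_deriv_Im_neg[of z] by (auto simp: curve_strip_def)
  qed
  moreover have "equivariant_map r - equivariant_map p = of_real (Re (equivariant_map r) - Re (equivariant_map p))"
    using assms(4,5) by (simp add: complex_eq_iff)
  ultimately have "Im (of_real (Re (equivariant_map r) - Re (equivariant_map p)) / (r - p)) < 0" by simp
  then have "- ((Re (equivariant_map r) - Re (equivariant_map p)) * (Im r - Im p)) / (norm (r - p))\<^sup>2 < 0"
    by (simp add: Im_divide cmod_power2 algebra_simps)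
  then show ?thesis using assms(3) by (simp add: zero_less_divide_iff)
qed

lemma isCont_equivariant_map: "Im \<tau> \<ge> sqrt 3 / 2 \<Longrightarrow> isCont equivariant_map \<tau>"
  by (rule equivariant_map_deriv) (assumption | erule DERIV_isCont)+

lemma unit_circle_real_value:
  assumes "Im \<tau> \<ge> sqrt 3 / 2" "norm \<tau> = 1" "equivariant_map \<tau> = of_real r"
  shows "\<bar>r\<bar> = 1"
proof -
  have pos: "Im \<tau> > 0" and nz: "deriv E6 \<tau> \<noteq> 0"
    using Im_pos[OF assms(1)] deriv_E6_nonzero[OF assms(1)] by auto
  \<comment> \<open>On the unit circle \<open>- 1 / \<tau> = - cnj \<tau>\<close>, so modularity and reflection compute \<open>deriv E6\<close> at the same point.\<close>
  have "\<tau> * cnj \<tau> = 1" using assms(2) complex_norm_square[of \<tau>] by simp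
  then have inv: "- 1 / \<tau> = - cnj \<tau>" using pos by (subst divide_eq_eq) (auto simp: mult.commute)
  have "\<tau> * deriv E6 \<tau> + 6 * E6 \<tau> = of_real r * deriv E6 \<tau>"
    using assms(3) nz unfolding equivariant_map_def by (simp add: field_simps)
  with deriv_E6_modular[OF pos, of 0 0 "-1" 1]
  have "deriv E6 (- cnj \<tau>) = \<tau> ^ 7 * (of_real r * deriv E6 \<tau>)"
    using inv by simp
  moreover have "deriv E6 (- cnj \<tau>) = - cnj (deriv E6 \<tau>)" using E6_reflect(2)[OF pos, of 0] by simp
  \<comment> \<open>Taking norms removes \<tau>^7 and the common derivative, so only |r| = 1
    remains; the sign is settled where the lemma is applied.\<close>
  ultimately have "norm (cnj (deriv E6 \<tau>)) = norm (\<tau> ^ 7 * (of_real r * deriv E6 \<tau>))"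
    by (metis norm_minus_cancel)
  then show ?thesis using nz assms(2) by (simp add: norm_mult norm_power)
qed

text \<open>Each horizontal segment has a real point by the intermediate value theorem, and only one
  by monotonicity. The graph is closed with values in a compact interval, hence the function is
  continuous.\<close>

lemma real_curve:
  obtains X where "continuous_on {sqrt 3 / 2..} X"
    "\<And>y. y \<ge> sqrt 3 / 2 \<Longrightarrow> Complex (X y) y \<in> curve_strip"
    "\<And>y. y \<ge> sqrt 3 / 2 \<Longrightarrow> Im (equivariant_map (Complex (X y) y)) = 0"
    "\<And>p. p \<in> curve_strip \<Longrightarrow> Im (equivariant_map p) = 0 \<Longrightarrow> p = Complex (X (Im p)) (Im p)"
proof -
  have unique: "p = r" if "p \<in> curve_strip" "r \<in> curve_strip" "Im p = Im r"
    "Im (equivariant_map p) = 0" "Im (equivariant_map r) = 0" for p r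
    using real_level_increasing[of p r] that by auto
  have ex: "\<exists>x. 1 / 8 \<le> x \<and> x \<le> 3 / 8 \<and> Im (equivariant_map (Complex x y)) = 0" if "y \<ge> sqrt 3 / 2" for y
  proof (rule IVT2')
    show "Im (equivariant_map (Complex (3 / 8) y)) \<le> 0" "0 \<le> Im (equivariant_map (Complex (1 / 8) y))"
      using Im_equivariant_map_neg[of "Complex (3 / 8) y"] Im_equivariant_map_pos[of "Complex (1 / 8) y"] that by simp_all
    show "continuous_on {1 / 8..3 / 8} (\<lambda>x. Im (equivariant_map (Complex x y)))"
      unfolding Complex_eq using that
      by (intro continuous_at_imp_continuous_on ballI continuous_intros isCont_o2[OF _ isCont_equivariant_map]) auto
  qed simp
  then obtain X where X: "\<And>y. y \<ge> sqrt 3 / 2 \<Longrightarrow> 1 / 8 \<le> X y \<and> X y \<le> 3 / 8 \<and> Im (equivariant_map (Complex (X y) y)) = 0"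
    by metis
  have strip: "Complex (X y) y \<in> curve_strip" if "y \<ge> sqrt 3 / 2" for y
    using X[OF that] that by (simp add: curve_strip_def)
  have eq: "p = Complex (X (Im p)) (Im p)" if "p \<in> curve_strip" "Im (equivariant_map p) = 0" for p
    using that X[of "Im p"] strip[of "Im p"] by (intro unique) (auto simp: curve_strip_def)
  have cont: "continuous_on {sqrt 3 / 2..} X"
  proof (rule continuous_from_closed_graph[where T = "{1 / 8..3 / 8}"])
    show "X \<in> {sqrt 3 / 2..} \<rightarrow> {1 / 8..3 / 8}" using X by auto
    have "(\<lambda>y. (y, X y)) ` {sqrt 3 / 2..} =
        ({sqrt 3 / 2..} \<times> {1 / 8..3 / 8}) \<inter> (\<lambda>z. Im (equivariant_map (Complex (snd z) (fst z)))) -` {0}"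
    proof (intro equalityI subsetI)
      fix z assume z: "z \<in> ({sqrt 3 / 2..} \<times> {1 / 8..3 / 8}) \<inter> (\<lambda>z. Im (equivariant_map (Complex (snd z) (fst z)))) -` {0}"
      then have "Complex (snd z) (fst z) \<in> curve_strip" by (auto simp: curve_strip_def)
      then have "Complex (snd z) (fst z) = Complex (X (fst z)) (fst z)"
        using eq[of "Complex (snd z) (fst z)"] z by simp
      then have "z = (fst z, X (fst z))" by (simp add: prod_eq_iff)
      then show "z \<in> (\<lambda>y. (y, X y)) ` {sqrt 3 / 2..}" by (rule image_eqI[of _ _ "fst z"]) (use z in auto)
    qed (use X in auto)
    moreover have "closed (({sqrt 3 / 2..} \<times> {1 / 8..3 / 8}) \<inter> (\<lambda>z. Im (equivariant_map (Complex (snd z) (fst z)))) -` {0})"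
    proof (rule continuous_closed_preimage)
      show "continuous_on ({sqrt 3 / 2..} \<times> {1 / 8..3 / 8}) (\<lambda>z. Im (equivariant_map (Complex (snd z) (fst z))))"
        unfolding Complex_eq
        by (intro continuous_at_imp_continuous_on ballI continuous_intros isCont_o2[OF _ isCont_equivariant_map]) auto
    qed (auto intro: closed_Times)
    ultimately show "closed ((\<lambda>y. (y, X y)) ` {sqrt 3 / 2..})" by simp
  qed simp
  show ?thesis by (rule that[OF cont strip _ eq]) (use X in auto)
qed

section \<open>Real levels in one half of the top third\<close>

definition half_triangle :: "complex set" where
  "half_triangle = {\<tau>. Im \<tau> > 0 \<and> 0 \<le> Re \<tau> \<and> Re \<tau> \<le> 1 / 2 \<and> norm \<tau> \<ge> 1}"

lemma half_triangle_Im_ge: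
  assumes "\<tau> \<in> half_triangle"
  shows "Im \<tau> \<ge> sqrt 3 / 2"
proof -
  have "(Re \<tau>)\<^sup>2 \<le> (1 / 2)\<^sup>2" using assms by (intro power_mono) (auto simp: half_triangle_def)
  moreover have "1\<^sup>2 \<le> (norm \<tau>)\<^sup>2" using assms by (intro power_mono) (auto simp: half_triangle_def)
  ultimately have "(Im \<tau>)\<^sup>2 \<ge> (sqrt 3 / 2)\<^sup>2" by (simp add: cmod_power2 power_divide)
  then show ?thesis by (rule power2_le_imp_le) (use assms in \<open>simp add: half_triangle_def\<close>)
qed

lemma half_triangle_real_in_strip:
  assumes "\<tau> \<in> half_triangle" "equivariant_map \<tau> = of_real r"
  shows "\<tau> \<in> curve_strip"
proof -
  have "Im (equivariant_map \<tau>) = 0" using assms(2) by simp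
  then show ?thesis
    using half_triangle_Im_ge[OF assms(1)] Im_equivariant_map_pos[of \<tau>] Im_equivariant_map_neg[of \<tau>] assms(1)
    unfolding curve_strip_def half_triangle_def by fastforce
qed

lemma half_triangle_unique:
  assumes "p \<in> half_triangle" "s \<in> half_triangle" "equivariant_map p = of_real r" "equivariant_map s = of_real r"
  shows "p = s"
proof (rule ccontr)
  assume "p \<noteq> s"
  from real_level_increasing[OF half_triangle_real_in_strip[OF assms(1,3)] half_triangle_real_in_strip[OF assms(2,4)] this]
  show False using assms(3,4) by simp
qed

text \<open>\<open>R\<close> is strictly increasing and equals 1 wherever the curve meets the unit
  circle, so it meets it once, and the part in the half triangle is the part above. The strict
  inequalities record when a point avoids edges shared with other pieces.\<close>

lemma half_triangle_level:
  shows "\<And>r \<tau>. \<tau> \<in> half_triangle \<Longrightarrow> equivariant_map \<tau> = of_real r \<Longrightarrow> r \<ge> 1"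
    and "\<And>r. r \<ge> 1 \<Longrightarrow> \<exists>\<tau> \<in> half_triangle. equivariant_map \<tau> = of_real r \<and>
          Re \<tau> < 1 / 2 \<and> (r = 1 \<longrightarrow> norm \<tau> = 1) \<and> (r > 1 \<longrightarrow> norm \<tau> > 1)"
proof -
  obtain X where X: "continuous_on {sqrt 3 / 2..} X"
    "\<And>y. y \<ge> sqrt 3 / 2 \<Longrightarrow> Complex (X y) y \<in> curve_strip"
    "\<And>y. y \<ge> sqrt 3 / 2 \<Longrightarrow> Im (equivariant_map (Complex (X y) y)) = 0"
    "\<And>p. p \<in> curve_strip \<Longrightarrow> Im (equivariant_map p) = 0 \<Longrightarrow> p = Complex (X (Im p)) (Im p)"
    using real_curve by blast
  define y0 :: real where "y0 = sqrt 3 / 2"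
  define g where "g y = norm (Complex (X y) y)" for y
  define R where "R y = Re (equivariant_map (Complex (X y) y))" for y
  have y0: "0 < y0" "y0 \<le> 1"
  proof -
    have "sqrt 3 \<le> (2::real)" by (rule real_le_lsqrt) auto
    then show "y0 \<le> 1" by (simp add: y0_def)
  qed (simp add: y0_def)
  have Xb: "1 / 8 \<le> X y" "X y \<le> 3 / 8" if "y \<ge> y0" for y
    using X(2)[of y] that by (simp_all add: curve_strip_def y0_def)
  have map: "equivariant_map (Complex (X y) y) = of_real (R y)" if "y \<ge> y0" for y
    using X(3)[of y] that by (simp add: R_def complex_eq_iff y0_def)
  have cc: "continuous_on {y0..} (\<lambda>y. Complex (X y) y)"
    unfolding Complex_eq by (intro continuous_intros X(1)[folded y0_def])
  have cg: "continuous_on {y0..} g" unfolding g_def by (intro continuous_intros cc)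
  have ch: "continuous_on (curve_strip) equivariant_map"
    by (intro continuous_at_imp_continuous_on ballI isCont_equivariant_map) (simp add: curve_strip_def)
  have cR: "continuous_on {y0..} R" unfolding R_def
    by (intro continuous_intros continuous_on_compose2[OF ch cc]) (use X(2) in \<open>auto simp: y0_def\<close>)
  have Rmono: "R y < R z" if "y0 \<le> y" "y < z" for y z
  proof -
    have "(R z - R y) * (z - y) > 0"
      unfolding R_def using real_level_increasing[of "Complex (X y) y" "Complex (X z) z"] X(2,3) that by (auto simp: y0_def)
    then show ?thesis using that by (simp add: zero_less_mult_iff)
  qed
  have R1: "R y = 1" if "y \<ge> y0" "g y = 1" for y
  proof -
    have "\<bar>R y\<bar> = 1" using unit_circle_real_value[OF _ _ map[OF that(1)]] that by (simp add: g_def y0_def)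
    moreover have "R y > 0" unfolding R_def
      using Re_equivariant_map_pos(2)[of "Complex (X y) y"] Xb[OF that(1)] that by (simp add: y0_def)
    ultimately show ?thesis by simp
  qed
  have g1: "g y \<ge> 1" if "y \<ge> 1" for y
    using that abs_Im_le_cmod[of "Complex (X y) y"] by (simp add: g_def)
  have g0: "g y0 \<le> 1"
  proof -
    have "(X y0)\<^sup>2 \<le> (3 / 8)\<^sup>2" using Xb[of y0] by (intro power_mono) auto
    then have "(g y0)\<^sup>2 \<le> 1\<^sup>2" by (simp add: g_def cmod_power2 y0_def power_divide)
    then show ?thesis by (rule power2_le_imp_le) simp
  qed
  have "\<exists>y\<ge>y0. y \<le> 1 \<and> g y = 1"
    by (rule IVT') (use g0 g1[of 1] y0 in \<open>auto intro: continuous_on_subset[OF cg]\<close>)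
  then obtain y1 where y1: "y1 \<ge> y0" "g y1 = 1" by auto
  have only: "y = y1" if "y \<ge> y0" "g y = 1" for y
    using Rmono[of y y1] Rmono[of y1 y] R1[OF that] R1[OF y1] that y1 by (cases y y1 rule: linorder_cases) auto
  have above: "g y > 1" if "y > y1" for y
  proof (rule ccontr)
    assume "\<not> g y > 1"
    \<comment> \<open>A return to the circle is forced because \<open>g\<close> is at least 1 from
      height 1 onwards; this contradicts the single crossing.\<close>
    then have "\<exists>z\<ge>y. z \<le> max y 1 \<and> g z = 1"
      using that y1 g1[of "max y 1"] by (intro IVT') (auto intro: continuous_on_subset[OF cg])
    then obtain z where "z \<ge> y" "g z = 1" by blast
    then show False using only[of z] that y1 by simp
  qed
  have below: "g y < 1" if "y0 \<le> y" "y < y1" for y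
  proof (rule ccontr)
    assume "\<not> g y < 1"
    then have "\<exists>z\<ge>y0. z \<le> y \<and> g z = 1"
      using that g0 by (intro IVT') (auto intro: continuous_on_subset[OF cg])
    then obtain z where "z \<ge> y0" "z \<le> y" "g z = 1" by blast
    then show False using only[of z] that by simp
  qed
  show "r \<ge> 1" if "\<tau> \<in> half_triangle" "equivariant_map \<tau> = of_real r" for r \<tau>
  proof -
    have s: "\<tau> \<in> curve_strip" by (rule half_triangle_real_in_strip[OF that])
    then have \<tau>: "\<tau> = Complex (X (Im \<tau>)) (Im \<tau>)" using X(4) that(2) by simp
    have "Im \<tau> \<ge> y0" using s by (simp add: curve_strip_def y0_def)
    moreover have "g (Im \<tau>) \<ge> 1" unfolding g_def using \<tau> that(1) by (simp add: half_triangle_def)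
    ultimately have "Im \<tau> \<ge> y1" using below[of "Im \<tau>"] by force
    then have "R (Im \<tau>) \<ge> R y1" using Rmono[of y1 "Im \<tau>"] y1(1) by (cases "Im \<tau> = y1") auto
    moreover have "R (Im \<tau>) = r" unfolding R_def using \<tau> that(2) by simp
    ultimately show ?thesis using R1[OF y1] by simp
  qed
  show "\<exists>\<tau> \<in> half_triangle. equivariant_map \<tau> = of_real r \<and> Re \<tau> < 1 / 2 \<and>
      (r = 1 \<longrightarrow> norm \<tau> = 1) \<and> (r > 1 \<longrightarrow> norm \<tau> > 1)" if "r \<ge> 1" for r
  proof -
    \<comment> \<open>Solved from 0.7 (Y - 90) - 41 >= 168 \<pi> r, using exp(2 \<pi> Y) >= Y in the
      growth bound.\<close>
    define Y where "Y = max y1 (90 + (168 * pi * r + 41) / 0.7)"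
    have Y: "Y \<ge> y1" "Y \<ge> y0" using y1 by (auto simp: Y_def)
    have "Y \<ge> 90 + (168 * pi * r + 41) / 0.7" unfolding Y_def by (rule max.cobounded2)
    then have "168 * pi * r \<le> 0.7 * (Y - 90) - 41" by (simp add: field_simps)
    also have "\<dots> \<le> 0.7 * (exp (2 * pi * Y) - 90) - 41"
    proof -
      have "1 * Y \<le> 2 * pi * Y" using Y(2) y0 pi_ge_two by (intro mult_right_mono) auto
      also have "\<dots> \<le> exp (2 * pi * Y)" using exp_ge_add_one_self[of "2 * pi * Y"] by linarith
      finally show ?thesis by simp
    qed
    also have "\<dots> \<le> 168 * pi * R Y" unfolding R_def
      using Re_equivariant_map_pos(1)[of "Complex (X Y) Y"] Xb[OF Y(2)] Y(2) by (simp add: y0_def)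
    finally have "r \<le> R Y" by simp
    moreover have "R y1 \<le> r" using R1[OF y1] that by simp
    ultimately have "\<exists>y\<ge>y1. y \<le> Y \<and> R y = r"
      using Y y1 by (intro IVT') (auto intro: continuous_on_subset[OF cR])
    then obtain y where y: "y \<ge> y1" "R y = r" by auto
    have yy: "y \<ge> y0" "y > 0" using y y1 y0 by auto
    have n: "(r = 1 \<longrightarrow> g y = 1) \<and> (r > 1 \<longrightarrow> g y > 1)"
    proof (cases "y = y1")
      case True
      then show ?thesis using R1[OF y1] y y1 by simp
    next
      case False
      then have "y > y1" using y by simp
      then show ?thesis using above[of y] Rmono[OF y1(1), of y] R1[OF y1] y by auto
    qed
    show ?thesis
    proof (rule bexI[of _ "Complex (X y) y"])
      show "equivariant_map (Complex (X y) y) = of_real r \<and> Re (Complex (X y) y) < 1 / 2 \<and>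
          (r = 1 \<longrightarrow> norm (Complex (X y) y) = 1) \<and> (r > 1 \<longrightarrow> norm (Complex (X y) y) > 1)"
        using map[OF yy(1)] n y(2) Xb[OF yy(1)] by (simp add: g_def)
      show "Complex (X y) y \<in> half_triangle"
        unfolding half_triangle_def using n that Xb[OF yy(1)] yy(2)
        by (cases "r = 1") (auto simp: g_def)
    qed
  qed
qed

section \<open>Counting in the ideal triangle\<close>

text \<open>The third of \<open>F0\<close> adjacent to infinity; the two circles meet at exp(i \<pi>
  / 3), the centre of the rotations.\<close>

definition full_triangle :: "complex set" where
  "full_triangle = {\<tau>. Im \<tau> > 0 \<and> 0 \<le> Re \<tau> \<and> Re \<tau> \<le> 1 \<and> norm \<tau> \<ge> 1 \<and> norm (\<tau> - 1) \<ge> 1}"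

lemma norm_diff_1_sq: "(norm (\<tau> - 1))\<^sup>2 = (norm \<tau>)\<^sup>2 - 2 * Re \<tau> + 1"
  unfolding cmod_power2 by (simp add: power2_eq_square algebra_simps)

lemma norm_le_norm_diff_1_iff: "norm \<tau> \<le> norm (\<tau> - 1) \<longleftrightarrow> Re \<tau> \<le> 1 / 2"
proof -
  have "norm \<tau> \<le> norm (\<tau> - 1) \<longleftrightarrow> (norm \<tau>)\<^sup>2 \<le> (norm (\<tau> - 1))\<^sup>2" by (simp add: abs_le_square_iff[symmetric])
  then show ?thesis unfolding norm_diff_1_sq by auto
qed

lemma reflect_involution: "1 - cnj (1 - cnj z) = z"
  by simp

lemma norm_reflect: "norm (1 - cnj z) = norm (z - 1)" "norm (1 - cnj z - 1) = norm z"
proof -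
  have "1 - cnj z = - cnj (z - 1)" by simp
  then show "norm (1 - cnj z) = norm (z - 1)" by (simp only: norm_minus_cancel complex_mod_cnj)
qed simp

lemma full_triangle_iff: "\<tau> \<in> full_triangle \<longleftrightarrow> \<tau> \<in> half_triangle \<or> 1 - cnj \<tau> \<in> half_triangle"
proof -
  have "norm \<tau> \<le> norm (\<tau> - 1)" if "Re \<tau> \<le> 1 / 2" using that norm_le_norm_diff_1_iff by simp
  moreover have "norm (\<tau> - 1) \<le> norm \<tau>" if "Re \<tau> \<ge> 1 / 2"
    using that norm_le_norm_diff_1_iff[of "1 - cnj \<tau>"] by (simp add: norm_reflect)
  ultimately show ?thesis
    unfolding full_triangle_def half_triangle_def mem_Collect_eq norm_reflect
    by (auto; linarith)
qed

lemma half_triangle_subset: "half_triangle \<subseteq> full_triangle"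
  using full_triangle_iff by blast

lemma full_triangle_Im_ge: "\<tau> \<in> full_triangle \<Longrightarrow> Im \<tau> \<ge> sqrt 3 / 2"
  using full_triangle_iff half_triangle_Im_ge[of \<tau>] half_triangle_Im_ge[of "1 - cnj \<tau>"] by auto

lemma equivariant_map_reflect:
  assumes "Im \<tau> > 0"
  shows "equivariant_map (1 - cnj \<tau>) = 1 - cnj (equivariant_map \<tau>)"
  using E6_reflect[OF assms, of 1] by (simp add: equivariant_map_def)

definition level_set :: "real \<Rightarrow> complex set" where
  "level_set r = {\<tau> \<in> full_triangle. equivariant_map \<tau> = of_real r}"

lemma level_set_reflect: "\<tau> \<in> level_set (1 - r) \<longleftrightarrow> 1 - cnj \<tau> \<in> level_set r"
proof -
  have "1 - cnj \<tau> \<in> full_triangle \<longleftrightarrow> \<tau> \<in> full_triangle"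
    unfolding full_triangle_def mem_Collect_eq norm_reflect by auto
  moreover have "equivariant_map (1 - cnj \<tau>) = of_real r \<longleftrightarrow> equivariant_map \<tau> = of_real (1 - r)"
    if "\<tau> \<in> full_triangle"
  proof -
    have "equivariant_map (1 - cnj \<tau>) = 1 - cnj (equivariant_map \<tau>)"
      using that by (intro equivariant_map_reflect) (simp add: full_triangle_def)
    then show ?thesis by (auto simp: complex_eq_iff)
  qed
  ultimately show ?thesis by (auto simp: level_set_def)
qed

lemma level_set_between:
  assumes "0 < r" "r < 1"
  shows "level_set r = {}"
proof (rule equals0I)
  fix \<tau> assume t: "\<tau> \<in> level_set r"
  then consider "\<tau> \<in> half_triangle" | "1 - cnj \<tau> \<in> half_triangle"
    using full_triangle_iff by (auto simp: level_set_def)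
  then show False
  proof cases
    case 1
    then show ?thesis using half_triangle_level(1)[of \<tau> r] t assms by (simp add: level_set_def)
  next
    case 2
    have "1 - cnj \<tau> \<in> level_set (1 - r)" using t level_set_reflect[of "1 - cnj \<tau>" r] by simp
    then show ?thesis using half_triangle_level(1)[OF 2, of "1 - r"] assms by (simp add: level_set_def)
  qed
qed

text \<open>The mirrored half has only levels r <= 0 and adds nothing. For r > 1 the point is
  strictly outside both circles, so it is not shared with a rotated third.\<close>

lemma level_set_ge_1:
  assumes "r \<ge> 1"
  obtains p where "level_set r = {p}" "Im p > 0" "r = 1 \<Longrightarrow> norm p = 1" "r > 1 \<Longrightarrow> norm p > 1 \<and> norm (p - 1) > 1"
proof -
  obtain p where p: "p \<in> half_triangle" "equivariant_map p = of_real r"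
      "Re p < 1 / 2" "r = 1 \<Longrightarrow> norm p = 1" "r > 1 \<Longrightarrow> norm p > 1"
    using half_triangle_level(2)[OF assms] by auto
  have "level_set r = {p}"
  proof (intro equalityI subsetI)
    fix \<tau> assume t: "\<tau> \<in> level_set r"
    then consider "\<tau> \<in> half_triangle" | "1 - cnj \<tau> \<in> half_triangle"
      using full_triangle_iff by (auto simp: level_set_def)
    then show "\<tau> \<in> {p}"
    proof cases
      case 1
      then show ?thesis using half_triangle_unique[OF 1 p(1) _ p(2)] t by (simp add: level_set_def)
    next
      case 2
      have "1 - cnj \<tau> \<in> level_set (1 - r)" using t level_set_reflect[of "1 - cnj \<tau>" r] by simp
      then show ?thesis using half_triangle_level(1)[OF 2, of "1 - r"] assms by (simp add: level_set_def)
    qed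
  qed (use p half_triangle_subset in \<open>auto simp: level_set_def\<close>)
  moreover have "norm (p - 1) > 1" if "r > 1"
    using p(3) p(5)[OF that] norm_le_norm_diff_1_iff[of p] by simp
  ultimately show ?thesis using that p by (auto simp: half_triangle_def)
qed

lemma level_set_le_0:
  assumes "level_set (1 - r) = {p}"
  shows "level_set r = {1 - cnj p}"
proof -
  have "\<tau> \<in> level_set r \<longleftrightarrow> \<tau> = 1 - cnj p" for \<tau>
  proof -
    have "\<tau> \<in> level_set r \<longleftrightarrow> 1 - cnj \<tau> \<in> level_set (1 - r)"
      using level_set_reflect[of "1 - cnj \<tau>" r] by simp
    also have "\<dots> \<longleftrightarrow> 1 - cnj \<tau> = p" using assms by simp
    also have "\<dots> \<longleftrightarrow> \<tau> = 1 - cnj p" using reflect_involution by metis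
    finally show ?thesis .
  qed
  then show ?thesis by blast
qed

lemma level_set_off_cusps:
  assumes "r > 1 \<or> r < 0"
  obtains p where "level_set r = {p}" "Im p > 0" "norm p > 1" "norm (p - 1) > 1"
proof (cases "r > 1")
  case True
  then show ?thesis using level_set_ge_1[of r] that by force
next
  case False
  then have "1 - r > 1" using assms by simp
  then obtain p where p: "level_set (1 - r) = {p}" "Im p > 0" "norm p > 1" "norm (p - 1) > 1"
    using level_set_ge_1[of "1 - r"] by force
  show ?thesis using that[OF level_set_le_0[OF p(1)]] p norm_reflect[of p] by simp
qed

text \<open>
  \<open>u\<close> and \<open>v\<close> are homogeneous coordinates of the value \<open>u / v\<close> of the equivariant map, so that its
  poles are included as \<open>v = 0\<close> and Moebius transformations act linearly.
\<close>

definition real_level :: "real \<Rightarrow> real \<Rightarrow> complex \<Rightarrow> bool" where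
  "real_level u v \<tau> \<longleftrightarrow> (of_real v * \<tau> - of_real u) * deriv E6 \<tau> + 6 * of_real v * E6 \<tau> = 0"

lemma real_level_full_triangle:
  "v \<noteq> 0 \<Longrightarrow> {\<tau> \<in> full_triangle. real_level u v \<tau>} = level_set (u / v)"
  "u \<noteq> 0 \<Longrightarrow> {\<tau> \<in> full_triangle. real_level u 0 \<tau>} = {}"
proof -
  have nz: "deriv E6 \<tau> \<noteq> 0" if "\<tau> \<in> full_triangle" for \<tau>
    using deriv_E6_nonzero full_triangle_Im_ge that by blast
  then show "{\<tau> \<in> full_triangle. real_level u 0 \<tau>} = {}" if "u \<noteq> 0"
    using that by (auto simp: real_level_def)
  assume v: "v \<noteq> 0"
  have "real_level u v \<tau> \<longleftrightarrow> equivariant_map \<tau> = of_real (u / v)" if "\<tau> \<in> full_triangle" for \<tau>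
    using nz[OF that] v unfolding real_level_def equivariant_map_def
    by (simp add: field_simps)
  then show "{\<tau> \<in> full_triangle. real_level u v \<tau>} = level_set (u / v)"
    by (auto simp: level_set_def)
qed

text \<open>The equivariance of the map, with (u, v) moved by the inverse matrix. No division by
  \<open>deriv E6\<close> occurs, so points of \<open>F0\<close> where it vanishes are
  covered.\<close>

lemma real_level_moebius:
  fixes a b c d :: int
  assumes "Im \<tau> > 0" "a * d - b * c = 1"
  shows "real_level u v ((of_int a * \<tau> + of_int b) / (of_int c * \<tau> + of_int d)) \<longleftrightarrow>
    real_level (of_int d * u - of_int b * v) (of_int a * v - of_int c * u) \<tau>"
proof -
  define j where "j = of_int c * \<tau> + of_int d"
  define n where "n = of_int a * \<tau> + of_int b"
  have j: "j \<noteq> 0" unfolding j_def by (rule moebius_denominator_nonzero[OF assms])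
  have det: "of_int a * of_int d - of_int b * of_int c = (1 :: complex)"
    using assms(2) by (metis of_int_1 of_int_diff of_int_mult)
  have M: "E6 (n / j) = j ^ 6 * E6 \<tau>" "deriv E6 (n / j) = j ^ 7 * (j * deriv E6 \<tau> + 6 * of_int c * E6 \<tau>)"
    unfolding j_def n_def using E6_modular[OF assms] deriv_E6_modular[OF assms] by auto
  define D where "D = deriv E6 \<tau>"
  define E where "E = E6 \<tau>"
  have "(of_real v * (n / j) - of_real u) * j = of_real v * n - of_real u * j" using j by (simp add: field_simps)
  then have "(of_real v * (n / j) - of_real u) * j * (j ^ 6 * (j * D + 6 * of_int c * E)) =
      (of_real v * n - of_real u * j) * (j ^ 6 * (j * D + 6 * of_int c * E))" by (simp only:)
  then have "(of_real v * (n / j) - of_real u) * (j ^ 7 * (j * D + 6 * of_int c * E)) + 6 * of_real v * (j ^ 6 * E)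
      = j ^ 6 * ((of_real v * n - of_real u * j) * (j * D + 6 * of_int c * E) + 6 * of_real v * E)"
    by (simp add: eval_nat_numeral algebra_simps)
  also have "(of_real v * n - of_real u * j) * (j * D + 6 * of_int c * E) + 6 * of_real v * E =
      j * ((of_real (of_int a * v - of_int c * u) * \<tau> - of_real (of_int d * u - of_int b * v)) * D
        + 6 * of_real (of_int a * v - of_int c * u) * E)"
  proof -
    \<comment> \<open>Inserting the determinant makes a common factor \<open>j\<close> appear, since
      c (a \<tau> + b) + a d - b c = a (c \<tau> + d).\<close>
    have "6 * of_real v * E = 6 * of_real v * E * (of_int a * of_int d - of_int b * of_int c)"
      using det by simp
    then show ?thesis unfolding j_def n_def by (simp add: algebra_simps)
  qed
  finally show ?thesis
    using j unfolding real_level_def M n_def[symmetric] j_def[symmetric] D_def E_def by simp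
qed

lemma F0_iff: "\<tau> \<in> F0 \<longleftrightarrow> Im \<tau> > 0 \<and> 0 \<le> Re \<tau> \<and> Re \<tau> \<le> 1 \<and> Re \<tau> \<le> (norm \<tau>)\<^sup>2"
proof -
  have "norm (\<tau> - 1 / 2) \<ge> 1 / 2 \<longleftrightarrow> (norm (\<tau> - 1 / 2))\<^sup>2 \<ge> (1 / 2)\<^sup>2"
    using abs_le_square_iff[of "1 / 2" "norm (\<tau> - 1 / 2)"] by simp
  also have "(norm (\<tau> - 1 / 2))\<^sup>2 = (norm \<tau>)\<^sup>2 - Re \<tau> + (1 / 2)\<^sup>2"
    unfolding cmod_power2 by (simp add: power2_eq_square algebra_simps)
  finally show ?thesis by (auto simp: F0_def upper_half_plane_def)
qed

lemma full_triangle_sq_iff: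
  "\<tau> \<in> full_triangle \<longleftrightarrow> Im \<tau> > 0 \<and> 0 \<le> Re \<tau> \<and> Re \<tau> \<le> 1 \<and> (norm \<tau>)\<^sup>2 \<ge> 1 \<and> (norm (\<tau> - 1))\<^sup>2 \<ge> 1"
  using abs_le_square_iff[of 1 "norm \<tau>"] abs_le_square_iff[of 1 "norm (\<tau> - 1)"]
  by (simp add: full_triangle_def)

text \<open>The rotations of order three about \<open>exp (\<i> \<pi> / 3)\<close>, which permute the cusps of \<open>F\<^sub>0\<close>.\<close>

definition rot :: "complex \<Rightarrow> complex" where "rot \<tau> = 1 / (1 - \<tau>)"
definition rot2 :: "complex \<Rightarrow> complex" where "rot2 \<tau> = (\<tau> - 1) / \<tau>"

lemma rot_parts:
  fixes \<tau> :: complex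
  assumes "Im \<tau> > 0"
  defines "M \<equiv> (norm \<tau>)\<^sup>2" and "N \<equiv> (norm (\<tau> - 1))\<^sup>2"
  shows "M > 0" "N > 0"
    "Im (rot \<tau>) = Im \<tau> / N" "Re (rot \<tau>) = (1 - Re \<tau>) / N" "(norm (rot \<tau>))\<^sup>2 = 1 / N" "(norm (rot \<tau> - 1))\<^sup>2 = M / N"
    "Im (rot2 \<tau>) = Im \<tau> / M" "Re (rot2 \<tau>) = 1 - Re \<tau> / M" "(norm (rot2 \<tau>))\<^sup>2 = N / M" "(norm (rot2 \<tau> - 1))\<^sup>2 = 1 / M"
    "rot (rot2 \<tau>) = \<tau>" "rot2 (rot \<tau>) = \<tau>"
proof -
  have nz: "\<tau> \<noteq> 0" "\<tau> - 1 \<noteq> 0" "1 - \<tau> \<noteq> 0" using assms(1) by (auto simp: complex_eq_iff)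
  then show "M > 0" "N > 0" by (simp_all add: M_def N_def)
  have c: "norm (1 - \<tau>) = norm (\<tau> - 1)" by (rule norm_minus_commute)
  have r2: "rot2 \<tau> = 1 - 1 / \<tau>" using nz by (simp add: rot2_def field_simps)
  have r1: "rot \<tau> - 1 = \<tau> / (1 - \<tau>)" using nz by (simp add: rot_def field_simps)
  show "Im (rot \<tau>) = Im \<tau> / N" "Re (rot \<tau>) = (1 - Re \<tau>) / N"
    unfolding N_def c[symmetric] by (simp_all add: rot_def Re_divide Im_divide cmod_power2)
  show "Im (rot2 \<tau>) = Im \<tau> / M" "Re (rot2 \<tau>) = 1 - Re \<tau> / M"
    unfolding r2 M_def by (simp_all add: Re_divide Im_divide cmod_power2)
  show "(norm (rot \<tau>))\<^sup>2 = 1 / N" "(norm (rot \<tau> - 1))\<^sup>2 = M / N" unfolding r1 unfolding rot_def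
    by (simp_all add: norm_divide power_divide N_def M_def c)
  show "(norm (rot2 \<tau>))\<^sup>2 = N / M" by (simp add: rot2_def norm_divide power_divide N_def M_def)
  show "(norm (rot2 \<tau> - 1))\<^sup>2 = 1 / M" unfolding r2 by (simp add: norm_divide power_divide M_def)
  show "rot (rot2 \<tau>) = \<tau>" unfolding rot_def r2 by simp
  show "rot2 (rot \<tau>) = \<tau>" unfolding rot_def rot2_def using nz by (simp add: divide_simps)
qed

text \<open>A point inside the unit circle about 0 is moved to the top third by \<open>rot2\<close>,
  which sends 0 to infinity; one inside the circle about 1 is moved by \<open>rot\<close>, which
  sends 1 to infinity.\<close>

lemma F0_decomposition: "F0 = full_triangle \<union> rot ` full_triangle \<union> rot2 ` full_triangle"
proof (intro equalityI subsetI)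
  fix \<tau> assume "\<tau> \<in> F0"
  then have t: "Im \<tau> > 0" "0 \<le> Re \<tau>" "Re \<tau> \<le> 1" "Re \<tau> \<le> (norm \<tau>)\<^sup>2" by (simp_all add: F0_iff)
  note parts = rot_parts[OF t(1)]
  have N: "(norm (\<tau> - 1))\<^sup>2 = (norm \<tau>)\<^sup>2 - 2 * Re \<tau> + 1" by (rule norm_diff_1_sq)
  consider "(norm \<tau>)\<^sup>2 \<ge> 1" "(norm (\<tau> - 1))\<^sup>2 \<ge> 1" | "Re \<tau> \<le> 1 / 2" "(norm \<tau>)\<^sup>2 < 1"
    | "Re \<tau> \<ge> 1 / 2" "(norm (\<tau> - 1))\<^sup>2 < 1" using N by linarith
  then show "\<tau> \<in> full_triangle \<union> rot ` full_triangle \<union> rot2 ` full_triangle"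
  proof cases
    case 1
    then show ?thesis using t by (simp add: full_triangle_sq_iff)
  next
    case 2
    have "rot2 \<tau> \<in> full_triangle"
      unfolding full_triangle_sq_iff parts(7-10) using parts(1,2) t 2 N norm_le_norm_diff_1_iff[of \<tau>]
      by (simp add: field_simps)
    then show ?thesis using parts(11) by (metis UnI1 UnI2 image_eqI)
  next
    case 3
    have "norm (\<tau> - 1) \<le> norm \<tau>" by (rule power2_le_imp_le) (use N 3 in simp_all)
    then have MN: "(norm (\<tau> - 1))\<^sup>2 \<le> (norm \<tau>)\<^sup>2" by (rule power_mono) simp
    \<comment> \<open>Here n, m, x, i stand for |\<tau> - 1|^2, |\<tau>|^2, 1 - Re \<tau>, Im
      \<tau>; the condition x <= n is the semicircle bounding \<open>F0\<close>.\<close>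
    have quot: "i / n > 0 \<and> 0 \<le> x / n \<and> x / n \<le> 1 \<and> 1 / n \<ge> 1 \<and> m / n \<ge> 1"
      if "n > 0" "n < 1" "n \<le> m" "0 \<le> x" "x \<le> n" "i > 0" for i m n x :: real
      using that by (simp add: field_simps)
    have "rot \<tau> \<in> full_triangle"
      unfolding full_triangle_sq_iff parts(3-6) by (rule quot) (use parts(2) t 3 N MN in simp_all)
    then show ?thesis using parts(12) by (metis UnI1 UnI2 image_eqI)
  qed
next
  fix \<tau> assume "\<tau> \<in> full_triangle \<union> rot ` full_triangle \<union> rot2 ` full_triangle"
  then obtain s where s: "s \<in> full_triangle" "\<tau> = s \<or> \<tau> = rot s \<or> \<tau> = rot2 s" by auto
  then have t: "Im s > 0" "0 \<le> Re s" "Re s \<le> 1" "(norm s)\<^sup>2 \<ge> 1" "(norm (s - 1))\<^sup>2 \<ge> 1"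
    by (simp_all add: full_triangle_sq_iff)
  have N: "(norm (s - 1))\<^sup>2 = (norm s)\<^sup>2 - 2 * Re s + 1" by (rule norm_diff_1_sq)
  note parts = rot_parts[OF t(1)]
  have "s \<in> F0" using t by (simp add: F0_iff)
  moreover have "rot s \<in> F0" unfolding F0_iff parts(3-6) using parts(1,2) t by (simp add: field_simps)
  moreover have quot: "i / m > 0 \<and> 0 \<le> 1 - x / m \<and> 1 - x / m \<le> 1 \<and> 1 - x / m \<le> n / m"
    if "m \<ge> 1" "n = m - 2 * x + 1" "0 \<le> x" "x \<le> 1" "i > 0" for i m n x :: real
    using that divide_right_mono[of "m - x" n m] by (simp add: diff_divide_distrib)
  have "rot2 s \<in> F0" unfolding F0_iff parts(7-10) by (rule quot) (use t N in simp_all)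
  ultimately show "\<tau> \<in> F0" using s by auto
qed

lemma real_level_rot:
  assumes "Im \<tau> > 0"
  shows "real_level u v (rot \<tau>) \<longleftrightarrow> real_level (u - v) u \<tau>" "real_level u v (rot2 \<tau>) \<longleftrightarrow> real_level v (v - u) \<tau>"
  using real_level_moebius[OF assms, of 0 1 1 "-1" u v] real_level_moebius[OF assms, of 1 0 "-1" 1 u v]
  by (simp_all add: rot_def rot2_def)

text \<open>In terms of r = u / v, the rotated thirds contribute the levels 1 - 1/r and 1/(1 - r) of
  the top third.\<close>

lemma real_level_F0:
  "{\<tau> \<in> F0. real_level u v \<tau>} = {\<tau> \<in> full_triangle. real_level u v \<tau>} \<union>
    rot ` {\<tau> \<in> full_triangle. real_level (u - v) u \<tau>} \<union> rot2 ` {\<tau> \<in> full_triangle. real_level v (v - u) \<tau>}"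
proof -
  have "Im \<tau> > 0" if "\<tau> \<in> full_triangle" for \<tau> using that by (simp add: full_triangle_def)
  then show ?thesis unfolding F0_decomposition using real_level_rot by blast
qed

text \<open>At level infinity the rotated thirds contribute levels 1 and 0. Their points coincide: p
  lies on the unit circle, so \<open>cnj p\<close> is 1 / p, and the point is on the common
  edge.\<close>

lemma card_real_level_cusp:
  assumes "u \<noteq> 0"
  shows "card {\<tau> \<in> F0. real_level u 0 \<tau>} = 1"
proof -
  obtain p where p: "level_set 1 = {p}" "Im p > 0" "norm p = 1"
    using level_set_ge_1[of 1] by force
  have "level_set 0 = {1 - cnj p}" using level_set_le_0[of 0 p] p(1) by simp
  then have "{\<tau> \<in> full_triangle. real_level (u - 0) u \<tau>} = {p}"
    "{\<tau> \<in> full_triangle. real_level 0 (0 - u) \<tau>} = {1 - cnj p}"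
    using assms p(1) real_level_full_triangle(1)[of u u] real_level_full_triangle(1)[of "- u" 0] by simp_all
  then have "{\<tau> \<in> F0. real_level u 0 \<tau>} = {rot p, rot2 (1 - cnj p)}"
    unfolding real_level_F0 real_level_full_triangle(2)[OF assms] by auto
  moreover have "rot2 (1 - cnj p) = rot p"
  proof -
    have "p * cnj p = 1" using p(3) complex_norm_square[of p] by simp
    moreover have "1 - p \<noteq> 0" "1 - cnj p \<noteq> 0" using p(2) by (auto simp: complex_eq_iff)
    ultimately show ?thesis unfolding rot_def rot2_def by (simp add: field_simps)
  qed
  ultimately show ?thesis by simp
qed

text \<open>Exactly one of r, 1 - 1/r, 1/(1 - r) lies strictly between 0 and 1 and contributes
  nothing. The other two give one point each, separated by the strict norm inequalities.\<close>

lemma card_real_level_generic: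
  assumes "u \<noteq> 0" "v \<noteq> 0" "u \<noteq> v"
  shows "card {\<tau> \<in> F0. real_level u v \<tau>} = 2"
proof -
  define r where "r = u / v"
  have r: "r \<noteq> 0" "r \<noteq> 1" using assms by (auto simp: r_def)
  have "(u - v) / u = 1 - 1 / r" "v / (v - u) = 1 / (1 - r)" using assms by (auto simp: r_def field_simps)
  then have eq: "{\<tau> \<in> F0. real_level u v \<tau>} =
      level_set r \<union> rot ` level_set (1 - 1 / r) \<union> rot2 ` level_set (1 / (1 - r))"
    unfolding real_level_F0 using assms real_level_full_triangle(1) by (simp add: r_def)
  consider "r > 1" | "r < 0" | "0 < r" "r < 1" using r by linarith
  then show ?thesis
  proof cases
    case 1
    have "level_set (1 - 1 / r) = {}" using 1 by (intro level_set_between) (auto simp: field_simps)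
    moreover obtain p where p: "level_set r = {p}" "Im p > 0" "norm p > 1" "norm (p - 1) > 1"
      using level_set_off_cusps[of r] 1 by metis
    moreover have "1 / (1 - r) < 0" using 1 by (simp add: divide_neg_pos field_simps)
    then obtain s where s: "level_set (1 / (1 - r)) = {s}" "Im s > 0" "norm s > 1" "norm (s - 1) > 1"
      using level_set_off_cusps by metis
    \<comment> \<open>p is outside the unit circle about 1, while \<open>rot2 s\<close> is inside
      because its distance from 1 is 1 / |s|.\<close>
    moreover have "p \<noteq> rot2 s"
    proof
      assume "p = rot2 s"
      then have "(norm (p - 1))\<^sup>2 = 1 / (norm s)\<^sup>2" using rot_parts(10)[OF s(2)] by simp
      moreover have "(norm (p - 1))\<^sup>2 > 1" "(norm s)\<^sup>2 > 1" using p(4) s(3) by (simp_all add: one_less_power)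
      moreover from this have "1 / (norm s)\<^sup>2 < 1" by (simp only: divide_less_eq_1_pos)
      ultimately show False by linarith
    qed
    ultimately show ?thesis unfolding eq by simp
  next
    case 2
    have "level_set (1 / (1 - r)) = {}" using 2 by (intro level_set_between) (auto simp: field_simps)
    moreover obtain p where p: "level_set r = {p}" "Im p > 0" "norm p > 1" "norm (p - 1) > 1"
      using level_set_off_cusps[of r] 2 by metis
    moreover have "1 - 1 / r > 1" using 2 by simp
    then obtain s where s: "level_set (1 - 1 / r) = {s}" "Im s > 0" "norm s > 1" "norm (s - 1) > 1"
      using level_set_off_cusps by metis
    moreover have "p \<noteq> rot s"
    proof
      assume "p = rot s"
      then have "(norm p)\<^sup>2 = 1 / (norm (s - 1))\<^sup>2" using rot_parts(5)[OF s(2)] by simp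
      moreover have "(norm p)\<^sup>2 > 1" "(norm (s - 1))\<^sup>2 > 1" using p(3) s(4) by (simp_all add: one_less_power)
      moreover from this have "1 / (norm (s - 1))\<^sup>2 < 1" by (simp only: divide_less_eq_1_pos)
      ultimately show False by linarith
    qed
    ultimately show ?thesis unfolding eq by simp
  next
    case 3
    have "level_set r = {}" using 3 by (intro level_set_between)
    moreover have "1 - 1 / r < 0" using 3 by (simp add: field_simps)
    then obtain p where p: "level_set (1 - 1 / r) = {p}" "Im p > 0" "norm p > 1" "norm (p - 1) > 1"
      using level_set_off_cusps by metis
    moreover have "1 / (1 - r) > 1" using 3 by (simp add: field_simps)
    then obtain s where s: "level_set (1 / (1 - r)) = {s}" "Im s > 0" "norm s > 1" "norm (s - 1) > 1"
      using level_set_off_cusps by metis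
    \<comment> \<open>\<open>rot p\<close> is closer to 0 than to 1, and \<open>rot2 s\<close> the
      other way round.\<close>
    moreover have "rot p \<noteq> rot2 s"
    proof
      assume e: "rot p = rot2 s"
      have "(norm p)\<^sup>2 > 1" "(norm (s - 1))\<^sup>2 > 1" using p(3) s(4) by (simp_all add: one_less_power)
      then have "(norm (rot p))\<^sup>2 < (norm (rot p - 1))\<^sup>2" "(norm (rot2 s - 1))\<^sup>2 < (norm (rot2 s))\<^sup>2"
        unfolding rot_parts(5,6)[OF p(2)] rot_parts(9,10)[OF s(2)]
        using rot_parts(1,2)[OF p(2)] rot_parts(1,2)[OF s(2)] by (simp_all add: divide_strict_right_mono)
      with e show False by simp
    qed
    ultimately show ?thesis unfolding eq by simp
  qed
qed

theorem theorem1p1: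
  fixes \<gamma> :: "int ^ 2 ^ 2"
  assumes "\<gamma> \<in> Gamma0 2"
  shows "(\<gamma> $ 2 $ 1 = 0 \<longrightarrow> card (critical_points E6 (linear_fractional \<gamma> ` F0)) = 1) \<and>
         (\<gamma> $ 2 $ 1 \<noteq> 0 \<longrightarrow> card (critical_points E6 (linear_fractional \<gamma> ` F0)) = 2)"
proof -
  define a b c d where "a = \<gamma> $ 1 $ 1" and "b = \<gamma> $ 1 $ 2" and "c = \<gamma> $ 2 $ 1" and "d = \<gamma> $ 2 $ 2"
  note abcd = this
  have det: "a * d - b * c = 1" and c2: "even c"
    using assms by (simp_all add: Gamma0_def det_2 abcd)
  have lf: "linear_fractional \<gamma> \<tau> = (of_int a * \<tau> + of_int b) / (of_int c * \<tau> + of_int d)" for \<tau>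
    by (simp add: linear_fractional_def abcd)
  \<comment> \<open>Evenness of c enters only here: it keeps the level - d / c away from the cusps 0
    and 1.\<close>
  have "odd d"
  proof
    assume "even d"
    then have "even (a * d - b * c)" using c2 by simp
    then show False using det by simp
  qed
  then have d: "d \<noteq> 0" "d \<noteq> - c" using c2 by auto
  have pos: "Im \<tau> > 0" if "\<tau> \<in> F0" for \<tau> using that by (simp add: F0_iff)
  have crit: "deriv E6 (linear_fractional \<gamma> \<tau>) = 0 \<longleftrightarrow> real_level (of_int d) (- of_int c) \<tau>"
    if "\<tau> \<in> F0" for \<tau>
  proof -
    have "deriv E6 (linear_fractional \<gamma> \<tau>) = 0 \<longleftrightarrow>
        (of_int c * \<tau> + of_int d) * deriv E6 \<tau> + 6 * of_int c * E6 \<tau> = 0"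
      unfolding lf deriv_E6_modular[OF pos[OF that] det]
      using moebius_denominator_nonzero[OF pos[OF that] det] by simp
    also have "(of_int c * \<tau> + of_int d) * deriv E6 \<tau> + 6 * of_int c * E6 \<tau> =
        - ((of_real (- of_int c) * \<tau> - of_real (of_int d)) * deriv E6 \<tau> + 6 * of_real (- of_int c) * E6 \<tau>)"
      by (simp add: algebra_simps)
    finally show ?thesis unfolding real_level_def neg_equal_0_iff_equal .
  qed
  \<comment> \<open>Injectivity transfers the count from \<open>F0\<close> to its image.\<close>
  have "inj_on (linear_fractional \<gamma>) F0"
  proof (rule inj_onI)
    fix x y assume xy: "x \<in> F0" "y \<in> F0" "linear_fractional \<gamma> x = linear_fractional \<gamma> y"
    have "of_int a * of_int d - of_int b * of_int c = (1 :: complex)"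
      using det by (metis of_int_1 of_int_diff of_int_mult)
    moreover have "(of_int a * x + of_int b) * (of_int c * y + of_int d) = (of_int a * y + of_int b) * (of_int c * x + of_int d)"
      using xy(3) unfolding lf
      by (subst (asm) frac_eq_eq) (use moebius_denominator_nonzero[OF _ det] pos xy in auto)
    then have "(of_int a * of_int d - of_int b * of_int c) * x = (of_int a * of_int d - of_int b * of_int c) * y"
      by (simp add: algebra_simps)
    ultimately show "x = y" by simp
  qed
  moreover have "critical_points E6 (linear_fractional \<gamma> ` F0) =
      linear_fractional \<gamma> ` {\<tau> \<in> F0. real_level (of_int d) (- of_int c) \<tau>}"
    using crit by (auto simp: critical_points_def)
  ultimately have "card (critical_points E6 (linear_fractional \<gamma> ` F0)) =
      card {\<tau> \<in> F0. real_level (of_int d) (- of_int c) \<tau>}"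
    by (simp add: card_image inj_on_subset)
  moreover have "real_of_int d \<noteq> - real_of_int c" using d(2) by (metis of_int_eq_iff of_int_minus)
  ultimately show ?thesis
    using card_real_level_cusp[of "of_int d"] card_real_level_generic[of "of_int d" "- of_int c"] d
    by (simp add: abcd(3)[symmetric])
qed

end
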